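(* Let $G$ be an 8-dimensional Riemannian Lie group containing $K=\mathbf{SU}(2)\times\mathbf{SU}(2)$ as a Lie subgroup, where $K$ carries the standard Riemannian metric induced by its Killing form, whose Lie algebra $\mathfrak g$ has the orthonormal basis $\{A,B,C,R,S,T,X,Y\}$ and the Lie bracket relations written out in the context, with real coefficients $\rho,b_{11},b_{21},c_{11},c_{12},c_{21},c_{22},s_{14},s_{24},t_{14},t_{15},t_{24},t_{25}$. Let $(\lambda_j,\mu_j,\nu_j)\in\mathbb R^3$ with $\lambda_j^2+\mu_j^2+\nu_j^2=1$ for $j=1,2$, assume $\lambda_1\neq 0$ and $\lambda_2\neq 0$, and let $J$ be the left-invariant almost Hermitian structure on $G$ given by the matrix in the context. Then $(G,g,J)$ belongs to the class $\mathcal W_3$ (Hermitian semi-Kähler) if and only if $\rho\neq 0$ and there exist $r_1,r_2\in\mathbb R$ such that $$c_{12}=-\frac{4\lambda_1}{\rho},\quad c_{11}=-\frac{4\mu_1}{\rho},\quad b_{11}=-\frac{4\nu_1}{\rho},\quad c_{22}=r_1\lambda_1,\quad c_{21}=r_1\mu_1,\quad b_{21}=r_1\nu_1,$$ $$t_{15}=-\frac{4\lambda_2}{\rho},\quad t_{14}=-\frac{4\mu_2}{\rho},\quad s_{14}=-\frac{4\nu_2}{\rho},\quad t_{25}=r_2\lambda_2,\quad t_{24}=r_2\mu_2,\quad s_{24}=r_2\nu_2.$$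
   Context: The Lie algebra $\mathfrak g$ of $G$ is identified with the left-invariant vector fields; the left-invariant metric $g$ on $G$ is the one for which $\{A,B,C,R,S,T,X,Y\}$ is orthonormal. The subalgebra $\mathfrak{su}(2)\oplus\mathfrak{su}(2)$ of $K$ is spanned by $A,B,C,R,S,T$, with $[A,B]=2C$, $[B,C]=2A$, $[C,A]=2B$, $[R,S]=2T$, $[S,T]=2R$, $[T,R]=2S$, and each of $A,B,C$ commutes with each of $R,S,T$. The remaining brackets are $$[A,X]=-b_{11}B-c_{11}C,\quad [A,Y]=-b_{21}B-c_{21}C,$$ $$[B,X]=b_{11}A-c_{12}C,\quad [B,Y]=b_{21}A-c_{22}C,$$ $$[C,X]=c_{11}A+c_{12}B,\quad [C,Y]=c_{21}A+c_{22}B,$$ $$[R,X]=-s_{14}S-t_{14}T,\quad [R,Y]=-s_{24}S-t_{24}T,$$ $$[S,X]=s_{14}R-t_{15}T,\quad [S,Y]=s_{24}R-t_{25}T,$$ $$[T,X]=t_{14}R+t_{15}S,\quad [T,Y]=t_{24}R+t_{25}S,$$ $$[X,Y]=\rho X+\theta_1A+\theta_2B+\theta_3C+\theta_4R+\theta_5S+\theta_6T,$$ where $$2\theta_1=-\rho c_{12}+b_{11}c_{21}-b_{21}c_{11},\quad 2\theta_2=\rho c_{11}+b_{11}c_{22}-b_{21}c_{12},\quad 2\theta_3=-\rho b_{11}+c_{11}c_{22}-c_{12}c_{21},$$ $$2\theta_4=-\rho t_{15}+s_{14}t_{24}-s_{24}t_{14},\quad 2\theta_5=\rho t_{14}+s_{14}t_{25}-s_{24}t_{15},\quad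 2\theta_6=-\rho s_{14}+t_{14}t_{25}-t_{15}t_{24}.$$ The 13 coefficients $\rho,b_{jk},c_{jk},s_{jk},t_{jk}$ may be arbitrary real numbers (the Jacobi identity then holds). In the ordered basis $(A,B,C,R,S,T,X,Y)$, acting on column vectors of coordinates, $J$ is the matrix $$\begin{pmatrix} 0&\nu_1&\mu_1&\lambda_1\lambda_2&-\lambda_1\mu_2&\lambda_1\nu_2&0&0\\ -\nu_1&0&\lambda_1&-\mu_1\lambda_2&\mu_1\mu_2&-\mu_1\nu_2&0&0\\ -\mu_1&-\lambda_1&0&\nu_1\lambda_2&-\nu_1\mu_2&\nu_1\nu_2&0&0\\ -\lambda_1\lambda_2&\mu_1\lambda_2&-\nu_1\lambda_2&0&\nu_2&\mu_2&0&0\\ \lambda_1\mu_2&-\mu_1\mu_2&\nu_1\mu_2&-\nu_2&0&\lambda_2&0&0\\ -\lambda_1\nu_2&\mu_1\nu_2&-\nu_1\nu_2&-\mu_2&-\lambda_2&0&0&0\\ 0&0&0&0&0&0&0&-1\\ 0&0&0&0&0&0&1&0 \end{pmatrix},$$ extended to $G$ by left translation; it satisfies $J^2=-\mathrm{id}$ and $g(JE,JF)=g(E,F)$. Let $\nabla$ be the Levi-Civita connection, $\omega(E,F)=g(JE,F)$ the Kähler form, and $\alpha(E,F,Z)=(\nabla_E\omega)(F,Z)=E(\omega(F,Z))-\omega(\nabla_EF,Z)-\omega(F,\nabla_EZ)$. For an orthonormal frame $e_1,\dots,e_8$ put $\tilde\alpha(Z)=-\sum_{j=1}^{8}\alpha(e_j,e_j,Z)$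 (this is the codifferential $\delta\omega(Z)$). The manifold $(G,g,J)$ belongs to $\mathcal W_3$ if $\alpha(E,F,Z)=\alpha(JE,JF,Z)$ for all $E,F,Z$ and $\tilde\alpha=0$. (The first condition is equivalent to integrability of $J$, i.e. vanishing of the Nijenhuis tensor $N_J(E,F)=[E,F]+J[JE,F]+J[E,JF]-[JE,JF]$; so $\mathcal W_3$ means that $J$ is integrable and $\delta\omega=0$.) *)

theory Defs
  imports "HOL-Analysis.Analysis" "HOL-Algebra.Group"
begin

section \<open>Smooth maps between normed spaces\<close>

text \<open>Intended for open \<open>S\<close> in a finite-dimensional space: there
  \<open>f\<close> is of class \<open>C^(k+1)\<close> iff it is differentiable and all
  its directional derivatives are of class \<open>C^k\<close>.\<close>

fun Ck_on :: "nat \<Rightarrow> 'a::real_normed_vector set \<Rightarrow> ('a \<Rightarrow> 'b::real_normed_vector) \<Rightarrow> bool" where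
  "Ck_on 0 S f \<longleftrightarrow> continuous_on S f"
| "Ck_on (Suc k) S f \<longleftrightarrow> f differentiable_on S \<and>
     (\<forall>v. Ck_on k S (\<lambda>x. frechet_derivative f (at x) v))"

definition smooth_on :: "'a::real_normed_vector set \<Rightarrow> ('a \<Rightarrow> 'b::real_normed_vector) \<Rightarrow> bool" where
  "smooth_on S f \<longleftrightarrow> (\<forall>k. Ck_on k S f)"

text \<open>Smoothness on an arbitrary subset (used for embedded submanifolds): local existence of
  smooth extensions to the ambient space.\<close>

definition smooth_on_subset :: "'a::real_normed_vector set \<Rightarrow> ('a \<Rightarrow> 'b::real_normed_vector) \<Rightarrow> bool" where
  "smooth_on_subset S f \<longleftrightarrow>
     (\<forall>x\<in>S. \<exists>W h. open W \<and> x \<in> W \<and> smooth_on W h \<and> (\<forall>y\<in>W \<inter> S. h y = f y))"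


section \<open>Smooth manifolds\<close>

text \<open>A chart is a pair of its domain and its coordinate map. The manifold is the whole type
  \<open>'g\<close>; its dimension is that of the model space \<open>'e\<close>.\<close>

type_synonym ('g, 'e) chart = "'g set \<times> ('g \<Rightarrow> 'e)"

definition smooth_atlas ::
    "('g::{t2_space,second_countable_topology}, 'e::euclidean_space) chart set \<Rightarrow> bool" where
  "smooth_atlas \<A> \<longleftrightarrow>
     (\<forall>(U,\<phi>)\<in>\<A>. open U \<and> open (\<phi> ` U) \<and> homeomorphism U (\<phi> ` U) \<phi> (inv_into U \<phi>)) \<and>
     (\<Union>(U,\<phi>)\<in>\<A>. U) = UNIV \<and>
     (\<forall>(U,\<phi>)\<in>\<A>. \<forall>(V,\<psi>)\<in>\<A>. smooth_on (\<phi> ` (U \<inter> V)) (\<psi> \<circ> inv_into U \<phi>))"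

definition smooth_functions ::
    "('g::{t2_space,second_countable_topology}, 'e::euclidean_space) chart set \<Rightarrow> ('g \<Rightarrow> real) set" where
  "smooth_functions \<A> = {f. \<forall>(U,\<phi>)\<in>\<A>. smooth_on (\<phi> ` U) (f \<circ> inv_into U \<phi>)}"

text \<open>Tangent vectors at \<open>p\<close> act on smooth functions as directional derivatives in
  coordinates. To make equality of tangent vectors extensional, they are set to \<open>0\<close> on
  functions that are not smooth.\<close>

type_synonym 'g tvec = "('g \<Rightarrow> real) \<Rightarrow> real"

definition tangent_space ::
    "('g::{t2_space,second_countable_topology}, 'e::euclidean_space) chart set \<Rightarrow> 'g \<Rightarrow> 'g tvec set" where
  "tangent_space \<A> p = {D. (\<forall>f. f \<notin> smooth_functions \<A> \<longrightarrow> D f = 0) \<and>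
     (\<forall>(U,\<phi>)\<in>\<A>. p \<in> U \<longrightarrow>
        (\<exists>v. \<forall>f\<in>smooth_functions \<A>. D f = frechet_derivative (f \<circ> inv_into U \<phi>) (at (\<phi> p)) v))}"

type_synonym 'g vfield = "'g \<Rightarrow> 'g tvec"

definition vector_fields ::
    "('g::{t2_space,second_countable_topology}, 'e::euclidean_space) chart set \<Rightarrow> 'g vfield set" where
  "vector_fields \<A> = {E. (\<forall>p. E p \<in> tangent_space \<A> p) \<and>
     (\<forall>f\<in>smooth_functions \<A>. (\<lambda>p. E p f) \<in> smooth_functions \<A>)}"

definition lie_bracket :: "'g vfield \<Rightarrow> 'g vfield \<Rightarrow> 'g vfield" where
  "lie_bracket E F = (\<lambda>p f. E p (\<lambda>q. F q f) - F p (\<lambda>q. E q f))"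

text \<open>Linear combination of vector fields with constant coefficients.\<close>

definition comb :: "real list \<Rightarrow> 'g vfield list \<Rightarrow> 'g vfield" where
  "comb cs Es = (\<lambda>p f. \<Sum>(c,E)\<leftarrow>zip cs Es. c * E p f)"

definition field_span :: "'g vfield list \<Rightarrow> 'g vfield set" where
  "field_span Es = {comb cs Es |cs. length cs = length Es}"


section \<open>Lie groups\<close>

definition lie_group ::
    "('g::{t2_space,second_countable_topology}, 'e::euclidean_space) chart set \<Rightarrow> 'g monoid \<Rightarrow> bool" where
  "lie_group \<A> G \<longleftrightarrow> smooth_atlas \<A> \<and> group G \<and> carrier G = UNIV \<and>
     continuous_on UNIV (\<lambda>(a,b). a \<otimes>\<^bsub>G\<^esub> b) \<and>
     (\<forall>(U,\<phi>)\<in>\<A>. \<forall>(V,\<psi>)\<in>\<A>. \<forall>(W,\<eta>)\<in>\<A>.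
        smooth_on {(x,y). x \<in> \<phi> ` U \<and> y \<in> \<psi> ` V \<and> inv_into U \<phi> x \<otimes>\<^bsub>G\<^esub> inv_into V \<psi> y \<in> W}
          (\<lambda>(x,y). \<eta> (inv_into U \<phi> x \<otimes>\<^bsub>G\<^esub> inv_into V \<psi> y))) \<and>
     continuous_on UNIV (\<lambda>a. inv\<^bsub>G\<^esub> a) \<and>
     (\<forall>(U,\<phi>)\<in>\<A>. \<forall>(V,\<psi>)\<in>\<A>.
        smooth_on {x \<in> \<phi> ` U. inv\<^bsub>G\<^esub> (inv_into U \<phi> x) \<in> V} (\<lambda>x. \<psi> (inv\<^bsub>G\<^esub> (inv_into U \<phi> x))))"

definition lie_algebra ::
    "('g::{t2_space,second_countable_topology}, 'e::euclidean_space) chart set \<Rightarrow> 'g monoid \<Rightarrow> 'g vfield set" where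
  "lie_algebra \<A> G = {E \<in> vector_fields \<A>.
     \<forall>a p. \<forall>f\<in>smooth_functions \<A>. E (a \<otimes>\<^bsub>G\<^esub> p) f = E p (\<lambda>q. f (a \<otimes>\<^bsub>G\<^esub> q))}"

definition lie_algebra_basis ::
    "('g::{t2_space,second_countable_topology}, 'e::euclidean_space) chart set \<Rightarrow> 'g monoid \<Rightarrow>
     'g vfield list \<Rightarrow> bool" where
  "lie_algebra_basis \<A> G Es \<longleftrightarrow> set Es \<subseteq> lie_algebra \<A> G \<and>
     field_span Es = lie_algebra \<A> G \<and>
     inj_on (\<lambda>cs. comb cs Es) {cs. length cs = length Es}"

definition SU2 :: "(complex^2^2) set" where
  "SU2 = {M. map_matrix cnj (transpose M) ** M = mat 1 \<and> det M = 1}"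

text \<open>\<open>G\<close> contains \<open>SU(2) \<times> SU(2)\<close> as a Lie subgroup (image of the
  injective smooth homomorphism \<open>\<iota>\<close>) whose Lie algebra is spanned by \<open>Ks\<close>: a
  left-invariant field belongs to it iff its value at the identity is the velocity of
  \<open>\<iota> \<circ> \<gamma>\<close> for a smooth curve \<open>\<gamma>\<close> in \<open>SU(2) \<times> SU(2)\<close>.
  An injective Lie group homomorphism is automatically an immersion, and a map into \<open>G\<close>
  is smooth iff its compositions with smooth functions on \<open>G\<close> are.\<close>

definition contains_SU2_SU2 ::
    "('g::{t2_space,second_countable_topology}, 'e::euclidean_space) chart set \<Rightarrow> 'g monoid \<Rightarrow>
     'g vfield list \<Rightarrow> bool" where
  "contains_SU2_SU2 \<A> G Ks \<longleftrightarrow> (\<exists>\<iota>.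
     inj_on \<iota> (SU2 \<times> SU2) \<and>
     (\<forall>M\<in>SU2. \<forall>N\<in>SU2. \<forall>M'\<in>SU2. \<forall>N'\<in>SU2. \<iota> (M ** M', N ** N') = \<iota> (M, N) \<otimes>\<^bsub>G\<^esub> \<iota> (M', N')) \<and>
     (\<forall>f\<in>smooth_functions \<A>. smooth_on_subset (SU2 \<times> SU2) (f \<circ> \<iota>)) \<and>
     {E \<in> lie_algebra \<A> G. \<exists>\<gamma>. smooth_on UNIV \<gamma> \<and> range \<gamma> \<subseteq> SU2 \<times> SU2 \<and> \<gamma> 0 = (mat 1, mat 1) \<and>
        (\<forall>f\<in>smooth_functions \<A>. ((\<lambda>t::real. f (\<iota> (\<gamma> t))) has_real_derivative E \<one>\<^bsub>G\<^esub> f) (at 0))}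
       = field_span Ks)"


section \<open>Riemannian and almost Hermitian structures\<close>

type_synonym 'g metric = "'g \<Rightarrow> 'g tvec \<Rightarrow> 'g tvec \<Rightarrow> real"

definition riemannian_metric ::
    "('g::{t2_space,second_countable_topology}, 'e::euclidean_space) chart set \<Rightarrow> 'g metric \<Rightarrow> bool" where
  "riemannian_metric \<A> g \<longleftrightarrow>
     (\<forall>p. \<forall>u\<in>tangent_space \<A> p. \<forall>v\<in>tangent_space \<A> p.
        g p u v = g p v u \<and>
        (\<forall>w\<in>tangent_space \<A> p. \<forall>a b. g p (\<lambda>f. a * u f + b * w f) v = a * g p u v + b * g p w v) \<and>
        (u \<noteq> (\<lambda>_. 0) \<longrightarrow> g p u u > 0)) \<and>
     (\<forall>E\<in>vector_fields \<A>. \<forall>F\<in>vector_fields \<A>. (\<lambda>p. g p (E p) (F p)) \<in> smooth_functions \<A>)"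

definition orthonormal_at :: "'g metric \<Rightarrow> 'g vfield list \<Rightarrow> 'g \<Rightarrow> bool" where
  "orthonormal_at g Es p \<longleftrightarrow>
     (\<forall>i<length Es. \<forall>j<length Es. g p ((Es ! i) p) ((Es ! j) p) = (if i = j then 1 else 0))"

text \<open>On the subalgebra spanned by the orthonormal fields \<open>Ks\<close>, the metric is a negative
  multiple of the Killing form \<open>(E, F) \<mapsto> tr (ad E \<circ> ad F)\<close>; the trace is computed
  in the basis \<open>Ks\<close>.\<close>

definition killing_metric :: "'g metric \<Rightarrow> 'g vfield list \<Rightarrow> bool" where
  "killing_metric g Ks \<longleftrightarrow> (\<exists>c>0. \<forall>E\<in>set Ks. \<forall>F\<in>set Ks. \<forall>p.
     g p (E p) (F p) = - c * (\<Sum>Z\<leftarrow>Ks. g p (lie_bracket E (lie_bracket F Z) p) (Z p)))"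

definition levi_civita ::
    "('g::{t2_space,second_countable_topology}, 'e::euclidean_space) chart set \<Rightarrow> 'g metric \<Rightarrow>
     ('g vfield \<Rightarrow> 'g vfield \<Rightarrow> 'g vfield) \<Rightarrow> bool" where
  "levi_civita \<A> g nabla \<longleftrightarrow>
     (\<forall>E\<in>vector_fields \<A>. \<forall>F\<in>vector_fields \<A>. nabla E F \<in> vector_fields \<A>) \<and>
     (\<forall>h\<in>smooth_functions \<A>. \<forall>E\<in>vector_fields \<A>. \<forall>F\<in>vector_fields \<A>. \<forall>Z\<in>vector_fields \<A>.
        nabla (\<lambda>p f. h p * E p f + F p f) Z = (\<lambda>p f. h p * nabla E Z p f + nabla F Z p f) \<and>
        nabla E (\<lambda>p f. h p * F p f + Z p f) = (\<lambda>p f. E p h * F p f + h p * nabla E F p f + nabla E Z p f)) \<and>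
     (\<forall>E\<in>vector_fields \<A>. \<forall>F\<in>vector_fields \<A>.
        (\<lambda>p f. nabla E F p f - nabla F E p f) = lie_bracket E F) \<and>
     (\<forall>E\<in>vector_fields \<A>. \<forall>F\<in>vector_fields \<A>. \<forall>Z\<in>vector_fields \<A>. \<forall>p.
        E p (\<lambda>q. g q (F q) (Z q)) = g p (nabla E F p) (Z p) + g p (F p) (nabla E Z p))"

type_synonym 'g endo = "'g \<Rightarrow> 'g tvec \<Rightarrow> 'g tvec"

definition almost_hermitian ::
    "('g::{t2_space,second_countable_topology}, 'e::euclidean_space) chart set \<Rightarrow> 'g metric \<Rightarrow> 'g endo \<Rightarrow> bool" where
  "almost_hermitian \<A> g J \<longleftrightarrow> riemannian_metric \<A> g \<and>
     (\<forall>p. \<forall>u\<in>tangent_space \<A> p. \<forall>v\<in>tangent_space \<A> p.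
        J p u \<in> tangent_space \<A> p \<and>
        (\<forall>a b. J p (\<lambda>f. a * u f + b * v f) = (\<lambda>f. a * J p u f + b * J p v f)) \<and>
        J p (J p u) = (\<lambda>f. - u f) \<and>
        g p (J p u) (J p v) = g p u v) \<and>
     (\<forall>E\<in>vector_fields \<A>. (\<lambda>p. J p (E p)) \<in> vector_fields \<A>)"

definition kaehler_form :: "'g metric \<Rightarrow> 'g endo \<Rightarrow> 'g vfield \<Rightarrow> 'g vfield \<Rightarrow> 'g \<Rightarrow> real" where
  "kaehler_form g J E F p = g p (J p (E p)) (F p)"

definition nabla_kaehler ::
    "'g metric \<Rightarrow> 'g endo \<Rightarrow> ('g vfield \<Rightarrow> 'g vfield \<Rightarrow> 'g vfield) \<Rightarrow>
     'g vfield \<Rightarrow> 'g vfield \<Rightarrow> 'g vfield \<Rightarrow> 'g \<Rightarrow> real" where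
  "nabla_kaehler g J nabla E F Z p =
     E p (kaehler_form g J F Z) - kaehler_form g J (nabla E F) Z p - kaehler_form g J F (nabla E Z) p"

text \<open>The codifferential condition is imposed at each point with respect to every list of fields
  that is an orthonormal basis there. By tensoriality its value does not depend on the choice, and
  it agrees with the one computed from a global orthonormal frame if there is one.\<close>

definition class_W3 ::
    "('g::{t2_space,second_countable_topology}, 'e::euclidean_space) chart set \<Rightarrow> 'g metric \<Rightarrow> 'g endo \<Rightarrow>
     ('g vfield \<Rightarrow> 'g vfield \<Rightarrow> 'g vfield) \<Rightarrow> bool" where
  "class_W3 \<A> g J nabla \<longleftrightarrow>
     (\<forall>E\<in>vector_fields \<A>. \<forall>F\<in>vector_fields \<A>. \<forall>Z\<in>vector_fields \<A>. \<forall>p.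
        nabla_kaehler g J nabla E F Z p
          = nabla_kaehler g J nabla (\<lambda>q. J q (E q)) (\<lambda>q. J q (F q)) Z p) \<and>
     (\<forall>p Es. \<forall>Z\<in>vector_fields \<A>.
        set Es \<subseteq> vector_fields \<A> \<and> length Es = DIM('e) \<and> orthonormal_at g Es p \<longrightarrow>
        - (\<Sum>E\<leftarrow>Es. nabla_kaehler g J nabla E E Z p) = 0)"


section \<open>The almost complex structure\<close>

text \<open>Row lists; columns are the coordinates of the images of the basis vectors.
  \<open>l\<close>, \<open>m\<close>, \<open>n\<close> stand for lambda, mu, nu.\<close>

definition J_matrix :: "real \<Rightarrow> real \<Rightarrow> real \<Rightarrow> real \<Rightarrow> real \<Rightarrow> real \<Rightarrow> real list list" where
  "J_matrix l1 m1 n1 l2 m2 n2 =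
    [[0,          n1,         m1,         l1 * l2,    - (l1 * m2), l1 * n2,     0, 0],
     [- n1,       0,          l1,         - (m1 * l2), m1 * m2,    - (m1 * n2), 0, 0],
     [- m1,       - l1,       0,          n1 * l2,    - (n1 * m2), n1 * n2,     0, 0],
     [- (l1 * l2), m1 * l2,   - (n1 * l2), 0,         n2,          m2,          0, 0],
     [l1 * m2,    - (m1 * m2), n1 * m2,   - n2,       0,           l2,          0, 0],
     [- (l1 * n2), m1 * n2,   - (n1 * n2), - m2,      - l2,        0,           0, 0],
     [0,          0,          0,          0,          0,           0,           0, - 1],
     [0,          0,          0,          0,          0,           0,           1, 0]]"

definition has_matrix :: "'g endo \<Rightarrow> 'g vfield list \<Rightarrow> real list list \<Rightarrow> bool" where
  "has_matrix J Es M \<longleftrightarrow>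
     (\<forall>j<length Es. (\<lambda>p. J p ((Es ! j) p)) = comb (map (\<lambda>row. row ! j) M) Es)"

end

theory Submission
  imports Defs
begin

text \<open>Everything is left-invariant, so the class \<open>\<W>\<^sub>3\<close> is decided on the Lie algebra: the
  fields \<open>A, \<dots>, Y\<close> span every tangent space, \<open>\<nabla>\<omega>\<close> is a tensor, and Koszul's formula
  expresses it through the bracket. There the first condition is the vanishing of the Nijenhuis
  tensor. Identify each factor \<open>su(2)\<close> with three-space and its bracket with twice the cross
  product; then \<open>X\<close> and \<open>Y\<close> act on the first factor as \<open>p \<times> _\<close> and \<open>q \<times> _\<close>, and \<open>J\<close> is a
  quarter turn about the unit vector \<open>u = (\<lambda>\<^sub>1, -\<mu>\<^sub>1, \<nu>\<^sub>1)\<close>, up to exchanging \<open>u\<close> with its counterpart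
  in the second factor. The codifferential vanishes iff \<open>p \<times> q - \<rho> p = 4 u\<close> (and likewise in the
  second factor), while integrability gives \<open>p \<times> u + (q \<times> u) \<times> u = 0\<close>. Write \<open>m = q \<times> u\<close>. If
  \<open>m \<noteq> 0\<close>, the two equations force \<open>p \<bullet> u = \<rho>\<close> and \<open>- |m|\<^sup>2 - \<rho>\<^sup>2 = 4\<close>; hence \<open>m = 0\<close>, so \<open>p\<close> and
  \<open>q\<close> are parallel to \<open>u\<close> and \<open>\<rho> p = - 4 u\<close>.\<close>

section \<open>Smooth functions and vector fields\<close>

lemma frechet_derivative_cong_open:
  assumes "open S" "x \<in> S" "\<And>y. y \<in> S \<Longrightarrow> f y = g y"
  shows "frechet_derivative f (at x) = frechet_derivative g (at x)"
proof -
  have "(f has_derivative D) (at x) \<longleftrightarrow> (g has_derivative D) (at x)" for D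
    using assms has_derivative_transform_within_open[of f D x UNIV S g]
      has_derivative_transform_within_open[of g D x UNIV S f] by auto
  then show ?thesis by (simp add: frechet_derivative_def)
qed

text \<open>Derivatives are taken in the ambient space, so agreement on \<open>S\<close> passes to
  them because \<open>S\<close> is open. This permits replacing a derivative by a formula valid at
  the points of \<open>S\<close> alone.\<close>

lemma Ck_on_cong:
  assumes "open S" "\<And>x. x \<in> S \<Longrightarrow> f x = g x"
  shows "Ck_on k S f \<longleftrightarrow> Ck_on k S g"
  using assms(2)
proof (induction k arbitrary: f g)
  case 0
  then show ?case using continuous_on_cong by (metis Ck_on.simps(1))
next
  case (Suc k)
  have "f differentiable_on S \<longleftrightarrow> g differentiable_on S"
    using Suc.prems by (metis differentiable_on_def differentiable_transform_within zero_less_one)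
  moreover have "Ck_on k S (\<lambda>x. frechet_derivative f (at x) v) \<longleftrightarrow>
      Ck_on k S (\<lambda>x. frechet_derivative g (at x) v)" for v
    using frechet_derivative_cong_open[OF assms(1) _ Suc.prems] by (intro Suc.IH) simp
  ultimately show ?case by simp
qed

lemma Ck_on_Suc_imp: "Ck_on (Suc k) S f \<Longrightarrow> Ck_on k S f"
proof (induction k arbitrary: f)
  case 0
  then show ?case by (simp add: differentiable_imp_continuous_on)
next
  case (Suc k)
  then show ?case using Ck_on.simps(2) by blast
qed

lemma frechet_derivative_has_derivative_on:
  assumes "open S" "f differentiable_on S" "x \<in> S"
  shows "(f has_derivative frechet_derivative f (at x)) (at x)"
  using assms frechet_derivative_works differentiable_on_eq_differentiable_at by blast

lemma Ck_on_add:
  assumes "open S"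
  shows "Ck_on k S f \<Longrightarrow> Ck_on k S g \<Longrightarrow> Ck_on k S (\<lambda>x. f x + g x)"
proof (induction k arbitrary: f g)
  case 0
  then show ?case by (simp add: continuous_on_add)
next
  case (Suc k)
  have D: "frechet_derivative (\<lambda>x. f x + g x) (at x) =
      (\<lambda>v. frechet_derivative f (at x) v + frechet_derivative g (at x) v)" if "x \<in> S" for x
    using Suc.prems that assms
    by (intro frechet_derivative_at[symmetric] has_derivative_add frechet_derivative_has_derivative_on) auto
  have "Ck_on k S (\<lambda>x. frechet_derivative (\<lambda>x. f x + g x) (at x) v) \<longleftrightarrow>
      Ck_on k S (\<lambda>x. frechet_derivative f (at x) v + frechet_derivative g (at x) v)" for v
    by (rule Ck_on_cong[OF assms]) (simp add: D)
  then have "Ck_on k S (\<lambda>x. frechet_derivative (\<lambda>x. f x + g x) (at x) v)" for v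
    using Suc.prems Suc.IH by simp
  then show ?case using Suc.prems by (simp add: differentiable_on_add)
qed

lemma Ck_on_mult:
  fixes f g :: "'a::real_normed_vector \<Rightarrow> 'b::real_normed_algebra"
  assumes "open S"
  shows "Ck_on k S f \<Longrightarrow> Ck_on k S g \<Longrightarrow> Ck_on k S (\<lambda>x. f x * g x)"
proof (induction k arbitrary: f g)
  case 0
  then show ?case by (simp add: continuous_on_mult)
next
  case (Suc k)
  have D: "frechet_derivative (\<lambda>x. f x * g x) (at x) =
      (\<lambda>v. f x * frechet_derivative g (at x) v + frechet_derivative f (at x) v * g x)" if "x \<in> S" for x
    using Suc.prems that assms
    by (intro frechet_derivative_at[symmetric] has_derivative_mult frechet_derivative_has_derivative_on) auto
  have "Ck_on k S (\<lambda>x. frechet_derivative (\<lambda>x. f x * g x) (at x) v) \<longleftrightarrow>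
      Ck_on k S (\<lambda>x. f x * frechet_derivative g (at x) v + frechet_derivative f (at x) v * g x)" for v
    by (rule Ck_on_cong[OF assms]) (simp add: D)
  \<comment> \<open>The product rule keeps one factor undifferentiated, so the factors themselves
    are needed at order \<open>k\<close> besides their derivatives.\<close>
  moreover have "Ck_on k S f" "Ck_on k S g"
    using Suc.prems by (auto intro: Ck_on_Suc_imp)
  then have "Ck_on k S (\<lambda>x. f x * frechet_derivative g (at x) v + frechet_derivative f (at x) v * g x)" for v
    using Suc.prems by (intro Ck_on_add[OF assms] Suc.IH) auto
  ultimately have "Ck_on k S (\<lambda>x. frechet_derivative (\<lambda>x. f x * g x) (at x) v)" for v
    by simp
  then show ?case using Suc.prems by (simp add: differentiable_on_mult)
qed

lemma Ck_on_const: "Ck_on k S (\<lambda>x. c)"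
proof (induction k arbitrary: c)
  case (Suc k)
  have "frechet_derivative (\<lambda>x::'a. c) (at x) v = 0" for x v
    using frechet_derivative_at[OF has_derivative_const] by metis
  then show ?case using Suc by simp
qed simp

section \<open>Smooth functions read in charts\<close>

lemma open_chart: "smooth_atlas \<A> \<Longrightarrow> (U, \<phi>) \<in> \<A> \<Longrightarrow> open (\<phi> ` U)"
  by (auto simp: smooth_atlas_def)

lemma smooth_functions_Ck:
  "f \<in> smooth_functions \<A> \<Longrightarrow> (U, \<phi>) \<in> \<A> \<Longrightarrow> Ck_on k (\<phi> ` U) (f \<circ> inv_into U \<phi>)"
  by (auto simp: smooth_functions_def smooth_on_def)

lemma smooth_functions_const: "(\<lambda>p. c) \<in> smooth_functions \<A>"
  by (auto simp: smooth_functions_def smooth_on_def o_def Ck_on_const)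

lemma smooth_functions_add:
  assumes "smooth_atlas \<A>" "f \<in> smooth_functions \<A>" "h \<in> smooth_functions \<A>"
  shows "(\<lambda>p. f p + h p) \<in> smooth_functions \<A>"
  unfolding smooth_functions_def smooth_on_def
proof (clarify)
  fix U \<phi> k assume c: "(U, \<phi>) \<in> \<A>"
  have "Ck_on k (\<phi> ` U) (f \<circ> inv_into U \<phi>)" "Ck_on k (\<phi> ` U) (h \<circ> inv_into U \<phi>)"
    using assms(2,3) c smooth_functions_Ck by blast+
  then show "Ck_on k (\<phi> ` U) ((\<lambda>p. f p + h p) \<circ> inv_into U \<phi>)"
    using Ck_on_add[OF open_chart[OF assms(1) c]] unfolding o_def by blast
qed

lemma smooth_functions_mult:
  assumes "smooth_atlas \<A>" "f \<in> smooth_functions \<A>" "h \<in> smooth_functions \<A>"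
  shows "(\<lambda>p. f p * h p) \<in> smooth_functions \<A>"
  unfolding smooth_functions_def smooth_on_def
proof (clarify)
  fix U \<phi> k assume c: "(U, \<phi>) \<in> \<A>"
  have "Ck_on k (\<phi> ` U) (f \<circ> inv_into U \<phi>)" "Ck_on k (\<phi> ` U) (h \<circ> inv_into U \<phi>)"
    using assms(2,3) c smooth_functions_Ck by blast+
  then show "Ck_on k (\<phi> ` U) ((\<lambda>p. f p * h p) \<circ> inv_into U \<phi>)"
    using Ck_on_mult[OF open_chart[OF assms(1) c]] unfolding o_def by blast
qed

lemma chart_at:
  assumes "smooth_atlas \<A>"
  obtains U \<phi> where "(U, \<phi>) \<in> \<A>" "p \<in> U"
proof -
  have "p \<in> (\<Union>(U, \<phi>)\<in>\<A>. U)"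
    using assms by (simp add: smooth_atlas_def)
  then show ?thesis using that by blast
qed

lemma smooth_function_has_derivative:
  assumes "smooth_atlas \<A>" "(U, \<phi>) \<in> \<A>" "p \<in> U" "f \<in> smooth_functions \<A>"
  shows "(f \<circ> inv_into U \<phi> has_derivative
    frechet_derivative (f \<circ> inv_into U \<phi>) (at (\<phi> p))) (at (\<phi> p))"
proof -
  have "Ck_on (Suc 0) (\<phi> ` U) (f \<circ> inv_into U \<phi>)"
    using assms smooth_functions_Ck by blast
  then show ?thesis
    using assms open_chart by (intro frechet_derivative_has_derivative_on[of "\<phi> ` U"]) auto
qed

section \<open>Tangent vectors as linear functionals on smooth functions\<close>

lemma tangent_nonsmooth: "u \<in> tangent_space \<A> p \<Longrightarrow> f \<notin> smooth_functions \<A> \<Longrightarrow> u f = 0"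
  by (auto simp: tangent_space_def)

lemma tangent_in_chart:
  assumes "u \<in> tangent_space \<A> p" "(U, \<phi>) \<in> \<A>" "p \<in> U"
  obtains v where "\<And>f. f \<in> smooth_functions \<A> \<Longrightarrow>
    u f = frechet_derivative (f \<circ> inv_into U \<phi>) (at (\<phi> p)) v"
proof -
  have "\<exists>v. \<forall>f\<in>smooth_functions \<A>. u f = frechet_derivative (f \<circ> inv_into U \<phi>) (at (\<phi> p)) v"
    using assms unfolding tangent_space_def by blast
  then show ?thesis using that by blast
qed

lemma tangent_space_lincomb:
  assumes "smooth_atlas \<A>" "u \<in> tangent_space \<A> p" "w \<in> tangent_space \<A> p"
  shows "(\<lambda>f. a * u f + b * w f) \<in> tangent_space \<A> p"
  unfolding tangent_space_def
proof (safe)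
  fix f assume "f \<notin> smooth_functions \<A>"
  then show "a * u f + b * w f = 0" using assms(2,3) by (simp add: tangent_nonsmooth)
next
  fix U \<phi> assume c: "(U, \<phi>) \<in> \<A>" "p \<in> U"
  obtain v v' where
    v: "\<And>f. f \<in> smooth_functions \<A> \<Longrightarrow> u f = frechet_derivative (f \<circ> inv_into U \<phi>) (at (\<phi> p)) v"
      "\<And>f. f \<in> smooth_functions \<A> \<Longrightarrow> w f = frechet_derivative (f \<circ> inv_into U \<phi>) (at (\<phi> p)) v'"
    using tangent_in_chart[OF assms(2) c] tangent_in_chart[OF assms(3) c] by metis
  have "a * u f + b * w f = frechet_derivative (f \<circ> inv_into U \<phi>) (at (\<phi> p)) (a *\<^sub>R v + b *\<^sub>R v')"
    if "f \<in> smooth_functions \<A>" for f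
  proof -
    interpret linear "frechet_derivative (f \<circ> inv_into U \<phi>) (at (\<phi> p))"
      using smooth_function_has_derivative[OF assms(1) c that] has_derivative_linear by blast
    show ?thesis using v that by (simp add: add scale)
  qed
  then show "\<exists>v. \<forall>f\<in>smooth_functions \<A>. a * u f + b * w f =
      frechet_derivative (f \<circ> inv_into U \<phi>) (at (\<phi> p)) v" by blast
qed

lemma tangent_space_zero: "(\<lambda>f. 0) \<in> tangent_space \<A> p" if "smooth_atlas \<A>"
proof -
  have "frechet_derivative (f \<circ> inv_into U \<phi>) (at (\<phi> p)) 0 = 0"
    if "(U, \<phi>) \<in> \<A>" "p \<in> U" "f \<in> smooth_functions \<A>" for U \<phi> f
    using smooth_function_has_derivative[OF \<open>smooth_atlas \<A>\<close> that] has_derivative_linear linear_0 by blast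
  then show ?thesis unfolding tangent_space_def by (force intro!: exI[of _ 0])
qed

lemma tangent_const:
  assumes "smooth_atlas \<A>" "u \<in> tangent_space \<A> p"
  shows "u (\<lambda>q. c) = 0"
proof -
  obtain U \<phi> where c: "(U, \<phi>) \<in> \<A>" "p \<in> U" using chart_at[OF assms(1)] by blast
  have "frechet_derivative ((\<lambda>q. c) \<circ> inv_into U \<phi>) (at (\<phi> p)) = (\<lambda>_. 0)"
    unfolding o_def by (rule frechet_derivative_at[symmetric]) simp
  then show ?thesis using tangent_in_chart[OF assms(2) c] smooth_functions_const by metis
qed

lemma tangent_lincomb:
  assumes "smooth_atlas \<A>" "u \<in> tangent_space \<A> p"
    and "f \<in> smooth_functions \<A>" "h \<in> smooth_functions \<A>"
  shows "u (\<lambda>q. a * f q + b * h q) = a * u f + b * u h"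
proof -
  obtain U \<phi> where c: "(U, \<phi>) \<in> \<A>" "p \<in> U" using chart_at[OF assms(1)] by blast
  obtain v where v: "\<And>f. f \<in> smooth_functions \<A> \<Longrightarrow>
      u f = frechet_derivative (f \<circ> inv_into U \<phi>) (at (\<phi> p)) v"
    using tangent_in_chart[OF assms(2) c] by metis
  have "((\<lambda>q. a * f q + b * h q) \<circ> inv_into U \<phi> has_derivative
      (\<lambda>v. a * frechet_derivative (f \<circ> inv_into U \<phi>) (at (\<phi> p)) v
         + b * frechet_derivative (h \<circ> inv_into U \<phi>) (at (\<phi> p)) v)) (at (\<phi> p))"
    using smooth_function_has_derivative[OF assms(1) c] assms(3,4) unfolding o_def
    by (intro has_derivative_add has_derivative_mult_right) auto
  from frechet_derivative_at[OF this, symmetric]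
  have "frechet_derivative ((\<lambda>q. a * f q + b * h q) \<circ> inv_into U \<phi>) (at (\<phi> p)) v = a * u f + b * u h"
    by (simp add: v assms(3,4))
  moreover have "(\<lambda>q. a * f q + b * h q) \<in> smooth_functions \<A>"
    using assms by (intro smooth_functions_add smooth_functions_mult smooth_functions_const)
  ultimately show ?thesis using v by simp
qed

lemma tangent_space_sum:
  assumes "smooth_atlas \<A>" "\<And>i. i \<in> I \<Longrightarrow> u i \<in> tangent_space \<A> p"
  shows "(\<lambda>f. \<Sum>i\<in>I. c i * u i f) \<in> tangent_space \<A> p"
  using assms(2)
proof (induction I rule: infinite_finite_induct)
  case (insert i I)
  then show ?case using tangent_space_lincomb[OF assms(1), of "u i" p "\<lambda>f. \<Sum>i\<in>I. c i * u i f" "c i" 1]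
    by simp
qed (simp_all add: tangent_space_zero[OF assms(1)])

section \<open>Vector fields and their combinations\<close>

lemma vector_field_tangent: "E \<in> vector_fields \<A> \<Longrightarrow> E p \<in> tangent_space \<A> p"
  by (auto simp: vector_fields_def)

text \<open>When \<open>f\<close> is not smooth, the convention that tangent vectors vanish on it
  makes this the zero function.\<close>

lemma vector_field_smooth: 
  assumes "E \<in> vector_fields \<A>"
  shows "(\<lambda>p. E p f) \<in> smooth_functions \<A>"
proof (cases "f \<in> smooth_functions \<A>")
  case True
  then show ?thesis using assms by (auto simp: vector_fields_def)
next
  case False
  then have "(\<lambda>p. E p f) = (\<lambda>p. 0)" using assms vector_field_tangent tangent_nonsmooth by fast
  then show ?thesis by (simp add: smooth_functions_const)
qed

lemma vector_fields_lincomb: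
  assumes "smooth_atlas \<A>" "E \<in> vector_fields \<A>" "F \<in> vector_fields \<A>" "h \<in> smooth_functions \<A>"
  shows "(\<lambda>p f. h p * E p f + F p f) \<in> vector_fields \<A>"
proof -
  have "(\<lambda>f. h p * E p f + F p f) \<in> tangent_space \<A> p" for p
    using tangent_space_lincomb[OF assms(1), of "E p" p "F p" "h p" 1] assms(2,3) by (simp add: vector_field_tangent)
  then show ?thesis
    using assms by (auto simp: vector_fields_def intro!: smooth_functions_add smooth_functions_mult)
qed

lemma vector_fields_zero: "smooth_atlas \<A> \<Longrightarrow> (\<lambda>p f. 0) \<in> vector_fields \<A>"
  by (auto simp: vector_fields_def tangent_space_zero smooth_functions_const)

lemma vector_fields_sum:
  assumes "smooth_atlas \<A>" "\<And>i. i \<in> I \<Longrightarrow> F i \<in> vector_fields \<A>"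
    "\<And>i. i \<in> I \<Longrightarrow> h i \<in> smooth_functions \<A>"
  shows "(\<lambda>p f. \<Sum>i\<in>I. h i p * F i p f) \<in> vector_fields \<A>"
  using assms(2,3)
proof (induction I rule: infinite_finite_induct)
  case (insert i I)
  then show ?case using vector_fields_lincomb[OF assms(1), of "F i"] by simp
qed (simp_all add: vector_fields_zero[OF assms(1)])

section \<open>Orthonormal frames with constant structure coefficients\<close>

locale riemannian_manifold =
  fixes \<A> :: "('g::{t2_space,second_countable_topology}, 'e::euclidean_space) chart set"
    and g :: "'g metric"
  assumes atlas: "smooth_atlas \<A>" and riem: "riemannian_metric \<A> g"
begin

lemma metric_sym:
  "u \<in> tangent_space \<A> p \<Longrightarrow> w \<in> tangent_space \<A> p \<Longrightarrow> g p u w = g p w u"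
  using riem by (auto simp: riemannian_metric_def)

lemma metric_lincomb:
  "u \<in> tangent_space \<A> p \<Longrightarrow> w \<in> tangent_space \<A> p \<Longrightarrow> z \<in> tangent_space \<A> p \<Longrightarrow>
    g p (\<lambda>f. a * u f + b * w f) z = a * g p u z + b * g p w z"
  using riem by (auto simp: riemannian_metric_def)

lemma metric_zero: "z \<in> tangent_space \<A> p \<Longrightarrow> g p (\<lambda>f. 0) z = 0"
  using metric_lincomb[OF tangent_space_zero[OF atlas] tangent_space_zero[OF atlas], of z p 0 0] by simp

lemma metric_smooth:
  "E \<in> vector_fields \<A> \<Longrightarrow> F \<in> vector_fields \<A> \<Longrightarrow> (\<lambda>p. g p (E p) (F p)) \<in> smooth_functions \<A>"
  using riem by (auto simp: riemannian_metric_def)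

lemma metric_sum:
  assumes "\<And>i. i \<in> I \<Longrightarrow> u i \<in> tangent_space \<A> p" "z \<in> tangent_space \<A> p"
  shows "g p (\<lambda>f. \<Sum>i\<in>I. c i * u i f) z = (\<Sum>i\<in>I. c i * g p (u i) z)"
  using assms(1)
proof (induction I rule: infinite_finite_induct)
  case (insert i I)
  then show ?case
    using metric_lincomb[of "u i" p "\<lambda>f. \<Sum>i\<in>I. c i * u i f" z "c i" 1] assms(2)
    by (simp add: tangent_space_sum[OF atlas])
qed (simp_all add: metric_zero[OF assms(2)])

end

text \<open>The frame is encoded as a linear isometry from a model space \<open>'v\<close> into the
  fields instead of a list, so that the bracket and \<open>J\<close> can later be ordinary maps on
  \<open>'v\<close>.\<close>

locale orthonormal_frame = riemannian_manifold \<A> g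
  for \<A> :: "('g::{t2_space,second_countable_topology}, 'e::euclidean_space) chart set"
    and g :: "'g metric" +
  fixes fr :: "'v::euclidean_space \<Rightarrow> 'g vfield"
  assumes dim: "DIM('v) = DIM('e)"
    and fr_field: "fr v \<in> vector_fields \<A>"
    and fr_lincomb: "fr (a *\<^sub>R v + b *\<^sub>R w) = (\<lambda>p f. a * fr v p f + b * fr w p f)"
    and fr_metric: "g p (fr v p) (fr w p) = v \<bullet> w"
begin

lemma fr_tangent: "fr v p \<in> tangent_space \<A> p"
  using fr_field vector_field_tangent by blast

lemma fr_zero: "fr 0 p = (\<lambda>f. 0)"
  using fr_lincomb[of 0 0 0 0] by simp

lemma fr_sum: "fr (\<Sum>i\<in>I. c i *\<^sub>R v i) p = (\<lambda>f. \<Sum>i\<in>I. c i * fr (v i) p f)"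
proof (induction I rule: infinite_finite_induct)
  case (insert i I)
  then show ?case
    using fr_lincomb[of "c i" "v i" 1 "\<Sum>i\<in>I. c i *\<^sub>R v i"] by simp
qed (simp_all add: fr_zero)

lemma fr_inj: "fr v p = fr w p \<Longrightarrow> v = w"
  using fr_metric by (metis inner_commute vector_eq_ldot)

text \<open>In a chart, the tangent space is the image of the model space under a linear map; the frame
  thus lifts to an injective linear map between spaces of equal dimension.\<close>

lemma tangent_space_frame:
  assumes u: "u \<in> tangent_space \<A> p"
  obtains v where "u = fr v p"
proof -
  obtain U \<phi> where c: "(U, \<phi>) \<in> \<A>" "p \<in> U" using chart_at[OF atlas] by blast
  define L where "L x f = (if f \<in> smooth_functions \<A>
    then frechet_derivative (f \<circ> inv_into U \<phi>) (at (\<phi> p)) x else 0)" for x :: 'e and f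
  have L_lin: "linear (\<lambda>x. L x f)" for f
    using smooth_function_has_derivative[OF atlas c] has_derivative_linear
    by (cases "f \<in> smooth_functions \<A>") (auto simp: L_def intro: linear_zero)
  have L_ex: "\<exists>x. w = L x" if w: "w \<in> tangent_space \<A> p" for w
  proof -
    obtain x where "\<And>f. f \<in> smooth_functions \<A> \<Longrightarrow>
        w f = frechet_derivative (f \<circ> inv_into U \<phi>) (at (\<phi> p)) x"
      using tangent_in_chart[OF w c] by blast
    then have "w = L x" using tangent_nonsmooth[OF w] by (auto simp: L_def)
    then show ?thesis by blast
  qed
  have "\<forall>b. \<exists>x. fr b p = L x" using L_ex fr_tangent by blast
  then obtain M0 where M0: "\<And>b. fr b p = L (M0 b)" by metis
  \<comment> \<open>\<open>M0\<close> is an arbitrary choice of chart coordinates; linearity is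
    enforced by extending its values on \<open>Basis\<close>.\<close>
  define M where "M v = (\<Sum>b\<in>Basis. (v \<bullet> b) *\<^sub>R M0 b)" for v
  have M_lin: "linear M"
    unfolding M_def by (intro linearI)
      (simp_all add: inner_add_left scaleR_add_left sum.distrib scaleR_sum_right)
  have LM: "L (M v) = fr v p" for v
  proof
    fix f
    have "L (M v) f = (\<Sum>b\<in>Basis. (v \<bullet> b) * L (M0 b) f)"
      unfolding M_def by (simp add: linear_sum[OF L_lin] linear_cmul[OF L_lin])
    also have "\<dots> = fr (\<Sum>b\<in>Basis. (v \<bullet> b) *\<^sub>R b) p f"
      by (simp only: fr_sum) (simp only: M0)
    finally show "L (M v) f = fr v p f" by (simp add: euclidean_representation)
  qed
  have "inj M" using LM fr_inj by (metis injI)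
  then have "dim (range M) = DIM('e)"
    using M_lin dim dim_image_eq[of M UNIV] by simp
  then have "range M = UNIV"
    using dim_eq_full[of "range M"] linear_subspace_image[OF M_lin subspace_UNIV]
    by (metis span_eq_iff)
  moreover obtain x where "u = L x" using L_ex[OF u] by blast
  ultimately obtain v where "u = L (M v)" by (metis surjD)
  then show ?thesis using that LM by simp
qed

definition coord :: "'g \<Rightarrow> 'g tvec \<Rightarrow> 'v" where
  "coord p u = (\<Sum>b\<in>Basis. g p u (fr b p) *\<^sub>R b)"

lemma coord_fr [simp]: "coord p (fr v p) = v"
  by (simp add: coord_def fr_metric euclidean_representation)

lemma fr_coord: "u \<in> tangent_space \<A> p \<Longrightarrow> fr (coord p u) p = u"
  using tangent_space_frame coord_fr by metis

lemma field_expand: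
  assumes "E \<in> vector_fields \<A>"
  shows "E = (\<lambda>p f. \<Sum>b\<in>Basis. g p (E p) (fr b p) * fr b p f)"
proof -
  have "E p = (\<lambda>f. \<Sum>b\<in>Basis. g p (E p) (fr b p) * fr b p f)" for p
    using fr_coord[OF vector_field_tangent[OF assms], of p] by (simp only: coord_def fr_sum)
  then show ?thesis by blast
qed

lemma metric_coord:
  "u \<in> tangent_space \<A> p \<Longrightarrow> w \<in> tangent_space \<A> p \<Longrightarrow> g p u w = coord p u \<bullet> coord p w"
  using fr_metric[of p "coord p u" "coord p w"] by (simp add: fr_coord)

end

section \<open>The Levi-Civita connection in a frame with constant brackets\<close>

locale levi_civita_frame = orthonormal_frame \<A> g fr
  for \<A> :: "('g::{t2_space,second_countable_topology}, 'e::euclidean_space) chart set"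
    and g :: "'g metric" and fr :: "'v::euclidean_space \<Rightarrow> 'g vfield" +
  fixes nabla :: "'g vfield \<Rightarrow> 'g vfield \<Rightarrow> 'g vfield"
    and br :: "'v \<Rightarrow> 'v \<Rightarrow> 'v"
  assumes lc: "levi_civita \<A> g nabla"
    and fr_bracket: "lie_bracket (fr v) (fr w) = fr (br v w)"
begin

lemma nabla_field:
  "E \<in> vector_fields \<A> \<Longrightarrow> F \<in> vector_fields \<A> \<Longrightarrow> nabla E F \<in> vector_fields \<A>"
  using lc by (auto simp: levi_civita_def)

lemma nabla_lincomb1:
  "h \<in> smooth_functions \<A> \<Longrightarrow> E \<in> vector_fields \<A> \<Longrightarrow> F \<in> vector_fields \<A> \<Longrightarrow> Z \<in> vector_fields \<A> \<Longrightarrow>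
    nabla (\<lambda>p f. h p * E p f + F p f) Z = (\<lambda>p f. h p * nabla E Z p f + nabla F Z p f)"
  using lc by (simp add: levi_civita_def)

lemma nabla_lincomb2:
  "h \<in> smooth_functions \<A> \<Longrightarrow> E \<in> vector_fields \<A> \<Longrightarrow> F \<in> vector_fields \<A> \<Longrightarrow> Z \<in> vector_fields \<A> \<Longrightarrow>
    nabla E (\<lambda>p f. h p * F p f + Z p f) = (\<lambda>p f. E p h * F p f + h p * nabla E F p f + nabla E Z p f)"
  using lc by (simp add: levi_civita_def)

lemma nabla_torsion:
  "E \<in> vector_fields \<A> \<Longrightarrow> F \<in> vector_fields \<A> \<Longrightarrow>
    (\<lambda>p f. nabla E F p f - nabla F E p f) = lie_bracket E F"
  using lc by (simp add: levi_civita_def)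

lemma nabla_metric:
  "E \<in> vector_fields \<A> \<Longrightarrow> F \<in> vector_fields \<A> \<Longrightarrow> Z \<in> vector_fields \<A> \<Longrightarrow>
    E p (\<lambda>q. g q (F q) (Z q)) = g p (nabla E F p) (Z p) + g p (F p) (nabla E Z p)"
  using lc by (simp add: levi_civita_def)

text \<open>The zero field is written as \<open>-1\<close> times itself plus itself, and the two
  covariant derivatives cancel.\<close>

lemma nabla_zero1: "Z \<in> vector_fields \<A> \<Longrightarrow> nabla (\<lambda>p f. 0) Z = (\<lambda>p f. 0)"
  using nabla_lincomb1[of "\<lambda>_. -1" "fr 0" "fr 0" Z] smooth_functions_const[of "-1" \<A>] fr_field[of 0]
  by (simp add: fr_zero)

lemma nabla_zero2: "E \<in> vector_fields \<A> \<Longrightarrow> nabla E (\<lambda>p f. 0) = (\<lambda>p f. 0)"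
  using nabla_lincomb2[of "\<lambda>_. -1" E "fr 0" "fr 0"] smooth_functions_const[of "-1" \<A>] fr_field[of 0]
  by (simp add: fr_zero)

lemma nabla_sum1:
  assumes "\<And>i. i \<in> I \<Longrightarrow> h i \<in> smooth_functions \<A>" "\<And>i. i \<in> I \<Longrightarrow> E i \<in> vector_fields \<A>"
    "Z \<in> vector_fields \<A>"
  shows "nabla (\<lambda>p f. \<Sum>i\<in>I. h i p * E i p f) Z = (\<lambda>p f. \<Sum>i\<in>I. h i p * nabla (E i) Z p f)"
  using assms(1,2)
proof (induction I rule: infinite_finite_induct)
  case (insert i I)
  then show ?case
    using nabla_lincomb1[of "h i" "E i" "\<lambda>p f. \<Sum>i\<in>I. h i p * E i p f" Z] assms(3)
    by (simp add: vector_fields_sum[OF atlas])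
qed (simp_all add: nabla_zero1[OF assms(3)])

lemma nabla_sum2:
  assumes "\<And>i. i \<in> I \<Longrightarrow> h i \<in> smooth_functions \<A>" "\<And>i. i \<in> I \<Longrightarrow> F i \<in> vector_fields \<A>"
    "E \<in> vector_fields \<A>"
  shows "nabla E (\<lambda>p f. \<Sum>i\<in>I. h i p * F i p f) =
    (\<lambda>p f. (\<Sum>i\<in>I. E p (h i) * F i p f) + (\<Sum>i\<in>I. h i p * nabla E (F i) p f))"
  using assms(1,2)
proof (induction I rule: infinite_finite_induct)
  case (insert i I)
  then show ?case
    using nabla_lincomb2[of "h i" E "F i" "\<lambda>p f. \<Sum>i\<in>I. h i p * F i p f"] assms(3)
    by (simp add: vector_fields_sum[OF atlas] algebra_simps)
qed (simp_all add: nabla_zero2[OF assms(3)])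

lemma nabla_expand1:
  assumes "E \<in> vector_fields \<A>" "Z \<in> vector_fields \<A>"
  shows "nabla E Z p f = (\<Sum>b\<in>Basis. g p (E p) (fr b p) * nabla (fr b) Z p f)"
  using nabla_sum1[of Basis "\<lambda>b p. g p (E p) (fr b p)" fr Z] field_expand[OF assms(1)]
    assms fr_field metric_smooth by simp

text \<open>Expanded in the frame, the differentiating field enters only through its coefficients at
  \<open>p\<close>.\<close>

lemma nabla_pointwise1:
  assumes "E \<in> vector_fields \<A>" "E' \<in> vector_fields \<A>" "Z \<in> vector_fields \<A>" "E p = E' p"
  shows "nabla E Z p = nabla E' Z p"
  using assms nabla_expand1 by (intro ext) simp

text \<open>The derivative terms of the general Koszul formula vanish because frame fields have
  constant inner products. Torsion-freeness and metricity, each for the three cyclic arrangements,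
  are six linear equations in the six inner products of covariant derivatives; the signed sum
  isolates one of them.\<close>

lemma koszul:
  "2 * g p (nabla (fr v) (fr w) p) (fr z p) = br v w \<bullet> z - br w z \<bullet> v + br z v \<bullet> w"
proof -
  have tors: "coord p (nabla (fr v) (fr w) p) - coord p (nabla (fr w) (fr v) p) = br v w" for v w
  proof -
    have "(\<lambda>f. nabla (fr v) (fr w) p f - nabla (fr w) (fr v) p f) = fr (br v w) p"
      using fun_cong[OF nabla_torsion[OF fr_field fr_field, of v w], of p] by (simp add: fr_bracket)
    then have "fr (1 *\<^sub>R coord p (nabla (fr v) (fr w) p) + (-1) *\<^sub>R coord p (nabla (fr w) (fr v) p)) p
        = fr (br v w) p"
      by (simp only: fr_lincomb fr_coord[OF vector_field_tangent[OF nabla_field[OF fr_field fr_field]]]) simp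
    from fr_inj[OF this] show ?thesis by simp
  qed
  have skew: "coord p (nabla (fr v) (fr w) p) \<bullet> z + w \<bullet> coord p (nabla (fr v) (fr z) p) = 0" for v w z
  proof -
    have "fr v p (\<lambda>q. w \<bullet> z) = 0" by (rule tangent_const[OF atlas fr_tangent])
    then show ?thesis
      using nabla_metric[OF fr_field fr_field fr_field, of v p w z]
      by (simp add: fr_metric metric_coord fr_tangent vector_field_tangent nabla_field fr_field)
  qed
  let ?n = "\<lambda>v w. coord p (nabla (fr v) (fr w) p)"
  have "g p (nabla (fr v) (fr w) p) (fr z p) = ?n v w \<bullet> z"
    by (simp add: metric_coord fr_tangent vector_field_tangent nabla_field fr_field)
  moreover have "br v w \<bullet> z = ?n v w \<bullet> z - ?n w v \<bullet> z" "br w z \<bullet> v = ?n w z \<bullet> v - ?n z w \<bullet> v"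
    "br z v \<bullet> w = ?n z v \<bullet> w - ?n v z \<bullet> w"
    by (simp_all add: tors[symmetric] inner_diff_left)
  moreover have "?n w v \<bullet> z + ?n w z \<bullet> v = 0" "?n z v \<bullet> w + ?n z w \<bullet> v = 0" "?n v w \<bullet> z + ?n v z \<bullet> w = 0"
    using skew[of w v z] skew[of z v w] skew[of v w z] by (simp_all add: inner_commute)
  ultimately show ?thesis by linarith
qed

end

text \<open>Basis independence of the trace: expand every \<open>b\<close> in \<open>B\<close> and
  sum over \<open>b\<close> first; the coefficients become \<open>x \<bullet> y\<close>, a Kronecker
  delta on \<open>B\<close>.\<close>

lemma sum_orthonormal_eq_sum_Basis:
  fixes \<beta> :: "'v::euclidean_space \<Rightarrow> 'v \<Rightarrow> real"
  assumes "bilinear \<beta>" and orth: "pairwise orthogonal B" "\<And>x. x \<in> B \<Longrightarrow> norm x = 1"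
    and card: "card B = DIM('v)"
  shows "(\<Sum>x\<in>B. \<beta> x x) = (\<Sum>b\<in>Basis. \<beta> b b)"
proof -
  have fin: "finite B" using card by (metis DIM_positive card_gt_0_iff)
  have "0 \<notin> B" using orth(2) by force
  then have "independent B" using orth(1) pairwise_orthogonal_independent by blast
  then have span: "span B = UNIV"
    using card dim_eq_card_independent dim_eq_full by metis
  have expand: "(\<Sum>x\<in>B. (b \<bullet> x) *\<^sub>R x) = b" for b
    using orthonormal_basis_expand[OF orth(1) orth(2) _ fin] span by auto
  have lin: "linear (\<lambda>x. \<beta> x y)" "linear (\<beta> x)" for x y
    using assms(1) by (auto simp: bilinear_def)
  have "\<beta> b b = (\<Sum>x\<in>B. \<Sum>y\<in>B. (x \<bullet> b) * (y \<bullet> b) * \<beta> x y)" for b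
  proof -
    have "\<beta> b b = \<beta> (\<Sum>x\<in>B. (b \<bullet> x) *\<^sub>R x) (\<Sum>y\<in>B. (b \<bullet> y) *\<^sub>R y)"
      by (simp only: expand)
    also have "\<dots> = (\<Sum>x\<in>B. \<Sum>y\<in>B. (x \<bullet> b) * (y \<bullet> b) * \<beta> x y)"
      by (subst linear_sum[OF lin(1)])
        (simp add: linear_sum[OF lin(2)] linear_cmul[OF lin(1)] linear_cmul[OF lin(2)]
          sum_distrib_left inner_commute mult_ac)
    finally show ?thesis .
  qed
  then have "(\<Sum>b\<in>Basis. \<beta> b b) = (\<Sum>b\<in>Basis. \<Sum>x\<in>B. \<Sum>y\<in>B. (x \<bullet> b) * (y \<bullet> b) * \<beta> x y)"
    by simp
  also have "\<dots> = (\<Sum>x\<in>B. \<Sum>b\<in>Basis. \<Sum>y\<in>B. (x \<bullet> b) * (y \<bullet> b) * \<beta> x y)"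
    by (rule sum.swap)
  also have "\<dots> = (\<Sum>x\<in>B. \<Sum>y\<in>B. \<Sum>b\<in>Basis. (x \<bullet> b) * (y \<bullet> b) * \<beta> x y)"
    by (intro sum.cong refl sum.swap)
  also have "\<dots> = (\<Sum>x\<in>B. \<Sum>y\<in>B. (x \<bullet> y) * \<beta> x y)"
  proof (intro sum.cong refl)
    fix x y
    show "(\<Sum>b\<in>Basis. (x \<bullet> b) * (y \<bullet> b) * \<beta> x y) = (x \<bullet> y) * \<beta> x y"
      by (simp only: euclidean_inner[of x y] sum_distrib_right)
  qed
  also have "\<dots> = (\<Sum>x\<in>B. \<Sum>y\<in>B. if y = x then \<beta> x x else 0)"
  proof (intro sum.cong refl)
    fix x y assume xy: "x \<in> B" "y \<in> B"
    show "(x \<bullet> y) * \<beta> x y = (if y = x then \<beta> x x else 0)"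
    proof (cases "y = x")
      case True
      then show ?thesis using orth(2)[OF xy(1)] by (simp add: dot_square_norm)
    next
      case False
      then have "x \<bullet> y = 0" using orth(1) xy by (auto simp: pairwise_def orthogonal_def)
      then show ?thesis using False by simp
    qed
  qed
  also have "\<dots> = (\<Sum>x\<in>B. \<beta> x x)" using fin by simp
  finally show ?thesis ..
qed

definition nijenhuis :: "('v::real_vector \<Rightarrow> 'v \<Rightarrow> 'v) \<Rightarrow> ('v \<Rightarrow> 'v) \<Rightarrow> 'v \<Rightarrow> 'v \<Rightarrow> 'v" where
  "nijenhuis br J e f = br e f + J (br (J e) f) + J (br e (J f)) - br (J e) (J f)"

text \<open>Koszul's formula for constant inner products.\<close>

definition invariant_connection :: "('v::real_inner \<Rightarrow> 'v \<Rightarrow> 'v) \<Rightarrow> 'v \<Rightarrow> 'v \<Rightarrow> 'v \<Rightarrow> real" where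
  "invariant_connection br e f z = (br e f \<bullet> z - br f z \<bullet> e + br z e \<bullet> f) / 2"

text \<open>This is the covariant derivative of the Kaehler form on invariant fields: the form is
  constant on them, and metricity together with skewness of \<open>J\<close> turns the two remaining
  terms into the ones below.\<close>

definition invariant_nabla_kaehler ::
    "('v::real_inner \<Rightarrow> 'v \<Rightarrow> 'v) \<Rightarrow> ('v \<Rightarrow> 'v) \<Rightarrow> 'v \<Rightarrow> 'v \<Rightarrow> 'v \<Rightarrow> real" where
  "invariant_nabla_kaehler br J e f z =
     invariant_connection br e (J f) z + invariant_connection br e f (J z)"

section \<open>The covariant derivative of the Kaehler form as an invariant tensor\<close>

locale hermitian_frame = levi_civita_frame \<A> g fr nabla br
  for \<A> :: "('g::{t2_space,second_countable_topology}, 'e::euclidean_space) chart set"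
    and g :: "'g metric" and fr :: "'v::euclidean_space \<Rightarrow> 'g vfield" and nabla br +
  fixes J :: "'g endo" and Jv :: "'v \<Rightarrow> 'v"
  assumes herm: "almost_hermitian \<A> g J"
    and fr_J: "J p (fr v p) = fr (Jv v) p"
    and bilinear_br: "bilinear br"
begin

lemma J_tangent: "u \<in> tangent_space \<A> p \<Longrightarrow> J p u \<in> tangent_space \<A> p"
  using herm by (auto simp: almost_hermitian_def)

lemma J_lincomb:
  "u \<in> tangent_space \<A> p \<Longrightarrow> w \<in> tangent_space \<A> p \<Longrightarrow>
    J p (\<lambda>f. a * u f + b * w f) = (\<lambda>f. a * J p u f + b * J p w f)"
  using herm by (auto simp: almost_hermitian_def)

lemma J_square: "u \<in> tangent_space \<A> p \<Longrightarrow> J p (J p u) = (\<lambda>f. - u f)"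
  using herm by (auto simp: almost_hermitian_def)

lemma J_metric:
  "u \<in> tangent_space \<A> p \<Longrightarrow> w \<in> tangent_space \<A> p \<Longrightarrow> g p (J p u) (J p w) = g p u w"
  using herm by (auto simp: almost_hermitian_def)

lemma J_field: "E \<in> vector_fields \<A> \<Longrightarrow> (\<lambda>p. J p (E p)) \<in> vector_fields \<A>"
  using herm by (auto simp: almost_hermitian_def)

lemma Jv_linear: "linear Jv"
proof (intro linearI)
  fix v w :: 'v and a :: real
  \<comment> \<open>Since the frame is injective at every point, a single arbitrary point suffices
    to transfer the properties of \<open>J\<close> to \<open>Jv\<close>.\<close>
  obtain p :: 'g where True by blast
  have *: "Jv (a *\<^sub>R v + b *\<^sub>R w) = a *\<^sub>R Jv v + b *\<^sub>R Jv w" for a b v w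
    using J_lincomb[OF fr_tangent fr_tangent, of p a v b w]
    by (intro fr_inj[of _ p]) (simp add: fr_J[symmetric] fr_lincomb)
  show "Jv (v + w) = Jv v + Jv w" using *[of 1 v 1 w] by simp
  show "Jv (a *\<^sub>R v) = a *\<^sub>R Jv v" using *[of a v 0 0] by simp
qed

lemma Jv_square: "Jv (Jv v) = - v"
proof -
  obtain p :: 'g where True by blast
  have "fr (Jv (Jv v)) p = (\<lambda>f. - fr v p f)"
    using J_square[OF fr_tangent, of p v] by (simp add: fr_J)
  also have "\<dots> = fr (- v) p" using fr_lincomb[of "-1" v 0 0] by simp
  finally show ?thesis by (rule fr_inj)
qed

lemma Jv_isometry: "Jv v \<bullet> Jv w = v \<bullet> w"
proof -
  obtain p :: 'g where True by blast
  show ?thesis using J_metric[OF fr_tangent fr_tangent, of p v w] by (simp add: fr_J fr_metric)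
qed

lemma Jv_skew: "Jv v \<bullet> w = - (v \<bullet> Jv w)"
  using Jv_isometry[of v "Jv w"] by (simp add: Jv_square)

lemma coord_J: "u \<in> tangent_space \<A> p \<Longrightarrow> coord p (J p u) = Jv (coord p u)"
  using fr_J[of p "coord p u"] coord_fr[of p "Jv (coord p u)"] by (simp add: fr_coord)

lemma metric_J_skew:
  assumes "u \<in> tangent_space \<A> p" "w \<in> tangent_space \<A> p"
  shows "g p (J p u) w = - g p u (J p w)"
  using assms by (simp add: metric_coord J_tangent coord_J Jv_skew)

text \<open>Metricity applied to \<open>g (J F) Z\<close> produces a term that cancels the last one
  of the definition. What remains contains no derivative of \<open>Z\<close>, which makes
  tensoriality in \<open>Z\<close> evident.\<close>

lemma nabla_kaehler_eq:
  assumes "E \<in> vector_fields \<A>" "F \<in> vector_fields \<A>" "Z \<in> vector_fields \<A>"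
  shows "nabla_kaehler g J nabla E F Z p =
    g p (nabla E (\<lambda>q. J q (F q)) p) (Z p) + g p (nabla E F p) (J p (Z p))"
proof -
  have "kaehler_form g J F Z = (\<lambda>q. g q (J q (F q)) (Z q))"
    by (auto simp: kaehler_form_def)
  then show ?thesis
    using nabla_metric[OF assms(1) J_field[OF assms(2)] assms(3), of p]
      metric_J_skew[of "nabla E F p" p "Z p"] assms
    by (simp add: nabla_kaehler_def kaehler_form_def vector_field_tangent nabla_field)
qed

text \<open>The derivatives of the coefficients of \<open>F\<close> cancel because \<open>J\<close> is skew and constant
  in the frame.\<close>

lemma nabla_kaehler_expand2:
  assumes E: "E \<in> vector_fields \<A>" and F: "F \<in> vector_fields \<A>" and Z: "Z \<in> vector_fields \<A>"
  shows "nabla_kaehler g J nabla E F Z p =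
    (\<Sum>b\<in>Basis. g p (F p) (fr b p) * nabla_kaehler g J nabla E (fr b) Z p)"
proof -
  let ?c = "\<lambda>b p. g p (F p) (fr b p)"
  have c: "?c b \<in> smooth_functions \<A>" for b
    using metric_smooth F fr_field by blast
  have JF: "(\<lambda>q. J q (F q)) = (\<lambda>q f. \<Sum>b\<in>Basis. ?c b q * fr (Jv b) q f)"
  proof
    fix q
    have "J q (F q) = fr (Jv (coord q (F q))) q"
      using fr_coord[OF vector_field_tangent[OF F], of q] fr_J by metis
    also have "Jv (coord q (F q)) = (\<Sum>b\<in>Basis. ?c b q *\<^sub>R Jv b)"
      by (simp add: coord_def linear_sum[OF Jv_linear] linear_cmul[OF Jv_linear])
    finally show "J q (F q) = (\<lambda>f. \<Sum>b\<in>Basis. ?c b q * fr (Jv b) q f)" by (simp add: fr_sum)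
  qed
  have split: "g p (\<lambda>f. (\<Sum>b\<in>Basis. a b * u b f) + (\<Sum>b\<in>Basis. a' b * u' b f)) w =
      (\<Sum>b\<in>Basis. a b * g p (u b) w) + (\<Sum>b\<in>Basis. a' b * g p (u' b) w)"
    if "\<And>b. u b \<in> tangent_space \<A> p" "\<And>b. u' b \<in> tangent_space \<A> p" "w \<in> tangent_space \<A> p"
    for a a' w and u u' :: "'v \<Rightarrow> 'g tvec"
    using metric_lincomb[of "\<lambda>f. \<Sum>b\<in>Basis. a b * u b f" p "\<lambda>f. \<Sum>b\<in>Basis. a' b * u' b f" w 1 1]
      that by (simp add: tangent_space_sum[OF atlas] metric_sum)
  have Zt: "Z p \<in> tangent_space \<A> p" "J p (Z p) \<in> tangent_space \<A> p"
    using Z J_tangent vector_field_tangent by blast+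
  have nt: "nabla E (fr v) p \<in> tangent_space \<A> p" for v
    using nabla_field[OF E fr_field] vector_field_tangent by blast
  have "nabla E (\<lambda>q. J q (F q)) p =
      (\<lambda>f. (\<Sum>b\<in>Basis. E p (?c b) * fr (Jv b) p f) + (\<Sum>b\<in>Basis. ?c b p * nabla E (fr (Jv b)) p f))"
    unfolding JF by (subst nabla_sum2) (simp_all add: c fr_field E)
  then have 1: "g p (nabla E (\<lambda>q. J q (F q)) p) (Z p) =
      (\<Sum>b\<in>Basis. E p (?c b) * g p (fr (Jv b) p) (Z p)) + (\<Sum>b\<in>Basis. ?c b p * g p (nabla E (fr (Jv b)) p) (Z p))"
    by (simp add: split fr_tangent nt Zt)
  have "nabla E F p =
      (\<lambda>f. (\<Sum>b\<in>Basis. E p (?c b) * fr b p f) + (\<Sum>b\<in>Basis. ?c b p * nabla E (fr b) p f))"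
    by (subst field_expand[OF F], subst nabla_sum2) (simp_all add: c fr_field E)
  then have 2: "g p (nabla E F p) (J p (Z p)) =
      (\<Sum>b\<in>Basis. E p (?c b) * g p (fr b p) (J p (Z p))) + (\<Sum>b\<in>Basis. ?c b p * g p (nabla E (fr b) p) (J p (Z p)))"
    by (simp add: split fr_tangent nt Zt)
  have 3: "g p (fr (Jv b) p) (Z p) = - g p (fr b p) (J p (Z p))" for b
    using metric_J_skew[OF fr_tangent Zt(1), of b] by (simp add: fr_J)
  have 4: "nabla_kaehler g J nabla E (fr b) Z p =
      g p (nabla E (fr (Jv b)) p) (Z p) + g p (nabla E (fr b) p) (J p (Z p))" for b
    using nabla_kaehler_eq[OF E fr_field Z, of b p] by (simp add: fr_J)
  show ?thesis
    unfolding nabla_kaehler_eq[OF E F Z] 1 2 3 4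
    by (simp add: sum.distrib sum_negf algebra_simps)
qed

lemma nabla_frame: "g p (nabla (fr v) (fr w) p) (fr z p) = invariant_connection br v w z"
proof -
  have "x = y / 2" if "2 * x = y" for x y :: real using that by simp
  from this[OF koszul] show ?thesis by (simp add: invariant_connection_def)
qed

lemma nabla_kaehler_frame:
  "nabla_kaehler g J nabla (fr e) (fr f) (fr z) p = invariant_nabla_kaehler br Jv e f z"
proof -
  have "nabla_kaehler g J nabla (fr e) (fr f) (fr z) p =
      g p (nabla (fr e) (fr (Jv f)) p) (fr z p) + g p (nabla (fr e) (fr f) p) (fr (Jv z) p)"
    using nabla_kaehler_eq[OF fr_field fr_field fr_field, of e f z p] by (simp add: fr_J)
  then show ?thesis
    by (simp add: invariant_nabla_kaehler_def nabla_frame)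
qed

text \<open>By tensoriality each field may be exchanged for the frame field with the same value at
  \<open>p\<close>: the first by \<open>nabla_pointwise1\<close>, the second by
  \<open>nabla_kaehler_expand2\<close>, the third by \<open>nabla_kaehler_eq\<close>.\<close>

lemma nabla_kaehler_coord:
  assumes E: "E \<in> vector_fields \<A>" and F: "F \<in> vector_fields \<A>" and Z: "Z \<in> vector_fields \<A>"
  shows "nabla_kaehler g J nabla E F Z p =
    invariant_nabla_kaehler br Jv (coord p (E p)) (coord p (F p)) (coord p (Z p))"
proof -
  let ?E = "fr (coord p (E p))" and ?F = "fr (coord p (F p))" and ?Z = "fr (coord p (Z p))"
  have EFZ: "?E p = E p" "?F p = F p" "?Z p = Z p"
    using assms by (simp_all add: fr_coord vector_field_tangent)
  have "nabla_kaehler g J nabla E F Z p = nabla_kaehler g J nabla ?E F Z p"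
    using nabla_pointwise1[OF E fr_field[of "coord p (E p)"], of _ p] assms
    by (simp add: nabla_kaehler_eq fr_field J_field EFZ)
  also have "\<dots> = nabla_kaehler g J nabla ?E ?F Z p"
    by (simp add: nabla_kaehler_expand2 fr_field assms EFZ)
  also have "\<dots> = nabla_kaehler g J nabla ?E ?F ?Z p"
    by (simp add: nabla_kaehler_eq fr_field assms EFZ)
  finally show ?thesis by (simp add: nabla_kaehler_frame)
qed

lemma bilinear_invariant_nabla_kaehler: "bilinear (\<lambda>e f. invariant_nabla_kaehler br Jv e f z)"
  using linear_add[OF Jv_linear] linear_cmul[OF Jv_linear]
  by (auto simp: bilinear_def invariant_nabla_kaehler_def invariant_connection_def
      bilinear_ladd[OF bilinear_br] bilinear_radd[OF bilinear_br] bilinear_lmul[OF bilinear_br]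
      bilinear_rmul[OF bilinear_br] inner_add_left inner_add_right field_simps intro!: linearI)

text \<open>Forwards, the conditions are tested on frame fields at one point. Backwards, coordinates
  at each point turn arbitrary fields into vectors of \<open>'v\<close>, and orthonormal fields into
  an orthonormal basis, over which the trace is the same as over \<open>Basis\<close>.\<close>

lemma class_W3_frame:
  "class_W3 \<A> g J nabla \<longleftrightarrow>
    (\<forall>e f z. invariant_nabla_kaehler br Jv e f z = invariant_nabla_kaehler br Jv (Jv e) (Jv f) z) \<and>
    (\<forall>z. (\<Sum>b\<in>Basis. invariant_nabla_kaehler br Jv b b z) = 0)"
proof (intro iffI conjI allI)
  assume W: "class_W3 \<A> g J nabla"
  obtain p :: 'g where True by blast
  show "invariant_nabla_kaehler br Jv e f z = invariant_nabla_kaehler br Jv (Jv e) (Jv f) z" for e f z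
  proof -
    have "nabla_kaehler g J nabla (fr e) (fr f) (fr z) p =
        nabla_kaehler g J nabla (\<lambda>q. J q (fr e q)) (\<lambda>q. J q (fr f q)) (fr z) p"
      using W fr_field by (simp add: class_W3_def)
    then show ?thesis by (simp add: fr_J nabla_kaehler_frame)
  qed
  show "(\<Sum>b\<in>Basis. invariant_nabla_kaehler br Jv b b z) = 0" for z
  proof -
    obtain bs :: "'v list" where bs: "set bs = Basis" "distinct bs"
      using finite_distinct_list[OF finite_Basis] by blast
    then have len: "length bs = DIM('e)" using dim distinct_card by metis
    have "orthonormal_at g (map fr bs) p"
    proof -
      have "bs ! i \<bullet> bs ! j = (if i = j then 1 else 0)" if "i < length bs" "j < length bs" for i j
        using bs(1) nth_mem[OF that(1)] nth_mem[OF that(2)] inner_Basis[of "bs ! i" "bs ! j"]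
          nth_eq_iff_index_eq[OF bs(2) that] by auto
      then show ?thesis by (simp add: orthonormal_at_def fr_metric)
    qed
    moreover have "set (map fr bs) \<subseteq> vector_fields \<A>" using fr_field by auto
    ultimately have "- (\<Sum>E\<leftarrow>map fr bs. nabla_kaehler g J nabla E E (fr z) p) = 0"
      using conjunct2[OF W[unfolded class_W3_def], THEN spec[of _ p],
          THEN spec[of _ "map fr bs"], THEN bspec[OF _ fr_field[of z]]] len
      by simp
    then have "(\<Sum>b\<leftarrow>bs. invariant_nabla_kaehler br Jv b b z) = 0"
      by (simp add: o_def nabla_kaehler_frame)
    then show ?thesis using bs by (simp add: sum_list_distinct_conv_sum_set)
  qed
next
  assume R: "(\<forall>e f z. invariant_nabla_kaehler br Jv e f z = invariant_nabla_kaehler br Jv (Jv e) (Jv f) z) \<and>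
    (\<forall>z. (\<Sum>b\<in>Basis. invariant_nabla_kaehler br Jv b b z) = 0)"
  have 1: "nabla_kaehler g J nabla E F Z p
      = nabla_kaehler g J nabla (\<lambda>q. J q (E q)) (\<lambda>q. J q (F q)) Z p"
    if "E \<in> vector_fields \<A>" "F \<in> vector_fields \<A>" "Z \<in> vector_fields \<A>" for E F Z p
    using that R by (simp add: nabla_kaehler_coord J_field coord_J vector_field_tangent)
  have 2: "(\<Sum>E\<leftarrow>Es. nabla_kaehler g J nabla E E Z p) = 0"
    if Z: "Z \<in> vector_fields \<A>" and Es: "set Es \<subseteq> vector_fields \<A>" "length Es = DIM('e)"
      and orth: "orthonormal_at g Es p" for Es Z p
  proof -
    define xs where "xs = map (\<lambda>E. coord p (E p)) Es"
    have len: "length xs = DIM('v)" using Es dim by (simp add: xs_def)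
    have inner: "xs ! i \<bullet> xs ! j = (if i = j then 1 else 0)" if "i < length xs" "j < length xs" for i j
    proof -
      have "Es ! i \<in> vector_fields \<A>" "Es ! j \<in> vector_fields \<A>"
        using that Es(1) nth_mem by (auto simp: xs_def)
      then show ?thesis
        using that orth metric_coord[of "(Es ! i) p" p "(Es ! j) p"]
        by (simp add: xs_def orthonormal_at_def vector_field_tangent)
    qed
    \<comment> \<open>A vector repeated at two indices would have inner product both 0 and 1;
      distinctness lets the list sum become a sum over a set.\<close>
    have dist: "distinct xs"
      unfolding distinct_conv_nth using inner by (metis zero_neq_one)
    have "pairwise orthogonal (set xs)"
      using inner by (auto simp: pairwise_def orthogonal_def in_set_conv_nth split: if_splits)
    moreover have "norm x = 1" if "x \<in> set xs" for x
      using that inner by (auto simp: in_set_conv_nth norm_eq_sqrt_inner)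
    moreover have "card (set xs) = DIM('v)" using len dist distinct_card by fastforce
    ultimately have "(\<Sum>x\<in>set xs. invariant_nabla_kaehler br Jv x x (coord p (Z p))) = 0"
      using sum_orthonormal_eq_sum_Basis[OF bilinear_invariant_nabla_kaehler] R by simp
    then have "(\<Sum>x\<leftarrow>xs. invariant_nabla_kaehler br Jv x x (coord p (Z p))) = 0"
      using dist by (simp add: sum_list_distinct_conv_sum_set)
    moreover have "(\<Sum>E\<leftarrow>Es. nabla_kaehler g J nabla E E Z p) =
        (\<Sum>E\<leftarrow>Es. invariant_nabla_kaehler br Jv (coord p (E p)) (coord p (E p)) (coord p (Z p)))"
      using Es(1) Z by (intro arg_cong[of _ _ sum_list] map_cong) (auto simp: nabla_kaehler_coord)
    ultimately show ?thesis by (simp add: xs_def o_def)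
  qed
  show "class_W3 \<A> g J nabla"
    unfolding class_W3_def using 1 2 by simp
qed

end

section \<open>Algebraic form of the conditions\<close>

locale hermitian_algebra =
  fixes br :: "'v::euclidean_space \<Rightarrow> 'v \<Rightarrow> 'v" and J :: "'v \<Rightarrow> 'v"
  assumes bilinear_br: "bilinear br" and br_skew: "br v w = - br w v"
    and linear_J: "linear J" and J_square: "J (J v) = - v" and J_isometry: "J v \<bullet> J w = v \<bullet> w"
begin

text \<open>Pairing with \<open>J z\<close> lets the isometry strip the outer \<open>J\<close> from
  the two middle terms.\<close>

lemma inner_nijenhuis:
  "nijenhuis br J e f \<bullet> J z =
    br e f \<bullet> J z - br (J e) (J f) \<bullet> J z + br (J e) f \<bullet> z + br e (J f) \<bullet> z"
  by (simp add: nijenhuis_def inner_add_left inner_diff_left J_isometry)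

text \<open>Both sides expand, by Koszul's formula and \<open>inner_nijenhuis\<close>, into the same
  pairings of brackets once skewness has ordered their arguments. The defect of the first condition
  thus depends on the Nijenhuis tensor alone.\<close>

lemma nabla_kaehler_diff:
  "2 * (invariant_nabla_kaehler br J e f z - invariant_nabla_kaehler br J (J e) (J f) z) =
    nijenhuis br J e f \<bullet> J z - nijenhuis br J f z \<bullet> J e + nijenhuis br J z e \<bullet> J f"
  using br_skew[of "J f" e] br_skew[of z e] br_skew[of f z]
    br_skew[of z "J e"] br_skew[of f "J e"] br_skew[of z "J f"]
    bilinear_lneg[OF bilinear_br] bilinear_rneg[OF bilinear_br]
  by (simp add: inner_nijenhuis invariant_nabla_kaehler_def invariant_connection_def J_square field_simps)

lemma nijenhuis_skew: "nijenhuis br J e f = - nijenhuis br J f e"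
  using br_skew[of "J e" f] br_skew[of e "J f"] br_skew[of e f] br_skew[of "J e" "J f"]
  by (simp add: nijenhuis_def linear_neg[OF linear_J])

lemma nabla_kaehler_invariant_iff:
  "(\<forall>e f z. invariant_nabla_kaehler br J e f z = invariant_nabla_kaehler br J (J e) (J f) z) \<longleftrightarrow>
    (\<forall>e f. nijenhuis br J e f = 0)"
proof (intro iffI allI)
  fix e f
  assume L: "\<forall>e f z. invariant_nabla_kaehler br J e f z = invariant_nabla_kaehler br J (J e) (J f) z"
  have D: "nijenhuis br J e f \<bullet> J z - nijenhuis br J f z \<bullet> J e + nijenhuis br J z e \<bullet> J f = 0" for e f z
    using nabla_kaehler_diff[of e f z] L by simp
  \<comment> \<open>Exchanging \<open>e\<close> and \<open>f\<close> in \<open>D\<close> changes the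
    sign of the first term and preserves the sum of the other two, so subtraction isolates the
    first.\<close>
  have "nijenhuis br J e f \<bullet> J z = 0" for z
    using D[of e f z] D[of f e z] nijenhuis_skew[of f e] nijenhuis_skew[of z f] nijenhuis_skew[of e z]
    by simp
  \<comment> \<open>With this \<open>z\<close>, \<open>J z\<close> is the Nijenhuis vector itself,
    whose square norm is therefore zero.\<close>
  from this[of "- J (nijenhuis br J e f)"] show "nijenhuis br J e f = 0"
    by (simp add: J_square linear_neg[OF linear_J])
next
  fix e f z
  assume "\<forall>e f. nijenhuis br J e f = 0"
  then show "invariant_nabla_kaehler br J e f z = invariant_nabla_kaehler br J (J e) (J f) z"
    using nabla_kaehler_diff[of e f z] by simp
qed

text \<open>Koszul's formula splits each summand into a divergence term, a trace term of
  \<open>ad (J z)\<close> and two terms mixing \<open>ad z\<close> with \<open>J\<close>; only the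
  first two kinds survive the summation.\<close>

lemma codifferential_eq:
  "2 * (\<Sum>b\<in>Basis. invariant_nabla_kaehler br J b b z) =
    (\<Sum>b\<in>Basis. br b (J b) \<bullet> z) + 2 * (\<Sum>b\<in>Basis. br (J z) b \<bullet> b)"
proof -
  txt \<open>The traces of \<open>ad z \<circ> J\<close> and its adjoint cancel: \<open>J\<close> maps \<open>Basis\<close> to an orthonormal basis.\<close>
  have "inj_on J Basis" by (metis J_square inj_onI neg_equal_iff_equal)
  have "bilinear (\<lambda>x y. br z x \<bullet> J y)"
    using bilinear_br linear_J
    by (auto simp: bilinear_def linear_add linear_cmul inner_add_left inner_add_right intro!: linearI)
  then have "(\<Sum>x\<in>J ` Basis. br z x \<bullet> J x) = (\<Sum>b\<in>Basis. br z b \<bullet> J b)"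
  proof (rule sum_orthonormal_eq_sum_Basis)
    show "pairwise orthogonal (J ` Basis)"
      by (auto simp: pairwise_def orthogonal_def J_isometry inner_Basis)
    show "norm x = 1" if "x \<in> J ` Basis" for x
      using that by (auto simp: norm_eq_sqrt_inner J_isometry)
    show "card (J ` Basis) = DIM('v)"
      by (rule card_image[OF \<open>inj_on J Basis\<close>])
  qed
  then have tr: "(\<Sum>b\<in>Basis. br z b \<bullet> J b) + (\<Sum>b\<in>Basis. br z (J b) \<bullet> b) = 0"
    by (simp add: sum.reindex[OF \<open>inj_on J Basis\<close>] J_square sum_negf)
  have "2 * invariant_nabla_kaehler br J b b z =
      br b (J b) \<bullet> z + 2 * (br (J z) b \<bullet> b) + (br z b \<bullet> J b + br z (J b) \<bullet> b)" for b
    \<comment> \<open>The first fact disposes of \<open>br b b\<close>, which equals its own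
      negative; the others bring \<open>z\<close> and \<open>J z\<close> to the front.\<close>
    using arg_cong[OF br_skew[of b b], of "\<lambda>w. w \<bullet> J z"] br_skew[of "J b" z] br_skew[of b "J z"]
    by (simp add: invariant_nabla_kaehler_def invariant_connection_def add_divide_distrib)
  then show ?thesis
    using tr by (simp add: sum_distrib_left sum.distrib)
qed

end

section \<open>The algebra modelled by cross products in three-space\<close>

unbundle cross3_syntax

lemma cross_cross_left: "(a \<times> b) \<times> c = (a \<bullet> c) *\<^sub>R b - (b \<bullet> c) *\<^sub>R a" for a b c :: "real^3"
  by (simp add: cross3_simps forall_3)

lemma cross_cross_right: "a \<times> (b \<times> c) = (a \<bullet> c) *\<^sub>R b - (a \<bullet> b) *\<^sub>R c" for a b c :: "real^3"
  by (simp add: cross3_simps forall_3)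

lemma inner_cross_cross: "(a \<times> b) \<bullet> (c \<times> d) = (a \<bullet> c) * (b \<bullet> d) - (a \<bullet> d) * (b \<bullet> c)" for a b c d :: "real^3"
  by (simp add: cross3_simps)

text \<open>An element \<open>(a, b, x, y)\<close> has the coordinates \<open>a\<close> in \<open>(A, B, C)\<close>, \<open>b\<close> in \<open>(R, S, T)\<close>, and
  \<open>x\<close>, \<open>y\<close> along \<open>X\<close>, \<open>Y\<close>. The bracket relations take the form below with
  \<open>p = (c\<^sub>1\<^sub>2, -c\<^sub>1\<^sub>1, b\<^sub>1\<^sub>1)\<close>, \<open>q = (c\<^sub>2\<^sub>2, -c\<^sub>2\<^sub>1, b\<^sub>2\<^sub>1)\<close>, \<open>p' = (t\<^sub>1\<^sub>5, -t\<^sub>1\<^sub>4, s\<^sub>1\<^sub>4)\<close>,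
  \<open>q' = (t\<^sub>2\<^sub>5, -t\<^sub>2\<^sub>4, s\<^sub>2\<^sub>4)\<close>; then \<open>xy_part\<close> yields \<open>(\<theta>\<^sub>1, \<theta>\<^sub>2, \<theta>\<^sub>3)\<close> and \<open>(\<theta>\<^sub>4, \<theta>\<^sub>5, \<theta>\<^sub>6)\<close>. The matrix of
  \<open>J\<close> is \<open>ext_J u v\<close> for \<open>u = (\<lambda>\<^sub>1, -\<mu>\<^sub>1, \<nu>\<^sub>1)\<close>, \<open>v = (\<lambda>\<^sub>2, -\<mu>\<^sub>2, \<nu>\<^sub>2)\<close>.\<close>

type_synonym algebra8 = "(real^3) \<times> (real^3) \<times> real \<times> real"

definition xy_part :: "real \<Rightarrow> real^3 \<Rightarrow> real^3 \<Rightarrow> real^3" where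
  "xy_part \<rho> p q = (1/2) *\<^sub>R (p \<times> q - \<rho> *\<^sub>R p)"

definition ext_bracket ::
  "real \<Rightarrow> real^3 \<Rightarrow> real^3 \<Rightarrow> real^3 \<Rightarrow> real^3 \<Rightarrow> algebra8 \<Rightarrow> algebra8 \<Rightarrow> algebra8" where
  "ext_bracket \<rho> p q p' q' = (\<lambda>(a, b, x, y) (a', b', x', y').
    (2 *\<^sub>R (a \<times> a') + p \<times> (x *\<^sub>R a' - x' *\<^sub>R a) + q \<times> (y *\<^sub>R a' - y' *\<^sub>R a) + (x * y' - x' * y) *\<^sub>R xy_part \<rho> p q,
     2 *\<^sub>R (b \<times> b') + p' \<times> (x *\<^sub>R b' - x' *\<^sub>R b) + q' \<times> (y *\<^sub>R b' - y' *\<^sub>R b) + (x * y' - x' * y) *\<^sub>R xy_part \<rho> p' q',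
     \<rho> * (x * y' - x' * y), 0))"

definition ext_J :: "real^3 \<Rightarrow> real^3 \<Rightarrow> algebra8 \<Rightarrow> algebra8" where
  "ext_J u v = (\<lambda>(a, b, x, y). (a \<times> u + (v \<bullet> b) *\<^sub>R u, b \<times> v - (u \<bullet> a) *\<^sub>R v, - y, x))"

lemma bilinear_ext_bracket: "bilinear (ext_bracket \<rho> p q p' q')"
  by (auto simp: bilinear_def ext_bracket_def split_beta cross3_simps forall_3 intro!: linearI)

lemma ext_bracket_skew: "ext_bracket \<rho> p q p' q' e f = - ext_bracket \<rho> p q p' q' f e"
  by (auto simp: ext_bracket_def split_beta cross3_simps forall_3)

lemma linear_ext_J: "linear (ext_J u v)"
  by (auto simp: ext_J_def split_beta cross3_simps forall_3 intro!: linearI)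

text \<open>Orthogonally to \<open>u\<close> and \<open>v\<close> the map is a quarter turn in each
  factor; moreover it sends \<open>(u, 0, 0, 0)\<close> to \<open>(0, - v, 0, 0)\<close> and
  \<open>(0, v, 0, 0)\<close> to \<open>(u, 0, 0, 0)\<close>.\<close>

lemma ext_J_square:
  assumes "norm u = 1" "norm v = 1"
  shows "ext_J u v (ext_J u v e) = - e"
proof -
  have [simp]: "u \<bullet> u = 1" "v \<bullet> v = 1" using assms by (simp_all add: dot_square_norm)
  show ?thesis
    by (cases e) (simp add: ext_J_def cross_add_left cross_mult_left Cross3.left_diff_distrib cross_cross_left
        inner_add_right inner_diff_right dot_cross_self inner_commute)
qed

lemma ext_J_isometry:
  assumes "norm u = 1" "norm v = 1"
  shows "ext_J u v e \<bullet> ext_J u v f = e \<bullet> f"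
proof -
  have [simp]: "u \<bullet> u = 1" "v \<bullet> v = 1" using assms by (simp_all add: dot_square_norm)
  show ?thesis
    by (cases e; cases f) (simp add: ext_J_def inner_add_left inner_add_right inner_diff_left
        inner_diff_right inner_cross_cross dot_cross_self inner_commute algebra_simps)
qed

lemma hermitian_algebra_ext:
  assumes "norm u = 1" "norm v = 1"
  shows "hermitian_algebra (ext_bracket \<rho> p q p' q') (ext_J u v)"
  by (rule hermitian_algebra.intro)
    (rule bilinear_ext_bracket ext_bracket_skew linear_ext_J ext_J_square[OF assms]
      ext_J_isometry[OF assms])+

section \<open>The two conditions in the model and their solution\<close>

lemma sum_Basis_prod:
  fixes f :: "('a::euclidean_space) * ('b::euclidean_space) \<Rightarrow> 'c::comm_monoid_add"
  shows "sum f Basis = (\<Sum>i\<in>Basis. f (i, 0)) + (\<Sum>i\<in>Basis. f (0, i))"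
proof -
  have "inj_on (\<lambda>u. (u::'a, 0::'b)) Basis" "inj_on (\<lambda>u. (0::'a, u::'b)) Basis"
    by (auto intro!: inj_onI)
  moreover have "(\<lambda>u. (u::'a, 0::'b)) ` Basis \<inter> (\<lambda>u. (0::'a, u::'b)) ` Basis = {}"
    by auto
  ultimately show ?thesis
    by (simp add: Basis_prod_def sum.union_disjoint sum.reindex)
qed

lemma sum_Basis_vec3: "(\<Sum>b\<in>Basis. f b) = f (axis 1 1) + f (axis 2 1) + f (axis 3 (1::real))"
  for f :: "real^3 \<Rightarrow> 'b::comm_monoid_add"
proof -
  have Basis: "(Basis :: (real^3) set) = (\<lambda>i. axis i 1) ` UNIV"
    by (auto simp: Basis_vec_def)
  have inj: "inj (\<lambda>i::3. axis i (1::real))"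
    by (simp add: inj_on_def axis_eq_axis)
  show ?thesis unfolding Basis sum.reindex[OF inj] sum_3 by simp
qed

text \<open>Each summand is \<open>(b \<bullet> u) *\<^sub>R b - u\<close>, so the three of them add
  up to \<open>u\<close> minus three times \<open>u\<close>.\<close>

lemma sum_Basis_cross_cross: "(\<Sum>b\<in>Basis. b \<times> (b \<times> u)) = - 2 *\<^sub>R u" for u :: "real^3"
  by (simp add: sum_Basis_vec3 cross3_simps forall_3 axis_def)

lemma codifferential_ext:
  assumes "norm u = 1" "norm v = 1"
  shows "(\<forall>z. (\<Sum>b\<in>Basis. invariant_nabla_kaehler (ext_bracket \<rho> p q p' q') (ext_J u v) b b z) = 0) \<longleftrightarrow>
    xy_part \<rho> p q = 2 *\<^sub>R u \<and> xy_part \<rho> p' q' = 2 *\<^sub>R v"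
proof -
  let ?br = "ext_bracket \<rho> p q p' q'" and ?J = "ext_J u v"
  interpret hermitian_algebra ?br ?J
    by (rule hermitian_algebra_ext[OF assms])
  \<comment> \<open>Cross products have trace zero; the only contribution is the \<open>X\<close>
    component of the bracket with \<open>X\<close>.\<close>
  have tr: "(\<Sum>b\<in>Basis. ?br (a, b', x, y) b \<bullet> b) = - \<rho> * y" for a b' x y
    by (simp add: sum_Basis_prod ext_bracket_def split_beta inner_add_left dot_cross_self
        cross_mult_right)
  \<comment> \<open>The basis vectors \<open>X\<close> and \<open>Y\<close> both contribute the
    bracket of \<open>X\<close> with \<open>Y\<close>, and the two factors contribute
    \<open>- 4 *\<^sub>R u\<close> and \<open>- 4 *\<^sub>R v\<close> by
    \<open>sum_Basis_cross_cross\<close>.\<close>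
  have div: "(\<Sum>b\<in>Basis. ?br b (?J b)) =
      (2 *\<^sub>R (xy_part \<rho> p q - 2 *\<^sub>R u), 2 *\<^sub>R (xy_part \<rho> p' q' - 2 *\<^sub>R v), 2 * \<rho>, 0)"
  proof -
    have "2 * w = 2 *\<^sub>R w" for w :: "real^3" by (simp add: vec_eq_iff)
    then show ?thesis
      using sum_Basis_cross_cross[of u] sum_Basis_cross_cross[of v]
      by (simp add: sum_Basis_prod ext_bracket_def split_beta ext_J_def prod_eq_iff fst_sum snd_sum
          scaleR_diff_right flip: scaleR_sum_right)
  qed
  \<comment> \<open>The \<open>X\<close> component \<open>2 * \<rho>\<close> of the divergence
    cancels against the trace of \<open>ad (J z)\<close>, since the \<open>Y\<close> component of
    \<open>J z\<close> is \<open>x\<close>.\<close>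
  have h: "2 * (\<Sum>b\<in>Basis. invariant_nabla_kaehler ?br ?J b b (a, b', x, y)) =
      2 * ((xy_part \<rho> p q - 2 *\<^sub>R u) \<bullet> a) + 2 * ((xy_part \<rho> p' q' - 2 *\<^sub>R v) \<bullet> b')" for a b' x y
    unfolding codifferential_eq inner_sum_left[symmetric] div
    by (simp add: ext_J_def tr)
  have half: "r = s + t" if "2 * r = 2 * s + 2 * t" for r s t :: real
    using that by simp
  have *: "(\<Sum>b\<in>Basis. invariant_nabla_kaehler ?br ?J b b (a, b', x, y)) =
      (xy_part \<rho> p q - 2 *\<^sub>R u) \<bullet> a + (xy_part \<rho> p' q' - 2 *\<^sub>R v) \<bullet> b'" for a b' x y
    by (rule half[OF h])
  show ?thesis
  proof
    assume "\<forall>z. (\<Sum>b\<in>Basis. invariant_nabla_kaehler ?br ?J b b z) = 0"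
    then have "(xy_part \<rho> p q - 2 *\<^sub>R u) \<bullet> a + (xy_part \<rho> p' q' - 2 *\<^sub>R v) \<bullet> b' = 0" for a b'
      using *[of a b' 0 0] by simp
    from this[of "xy_part \<rho> p q - 2 *\<^sub>R u" 0] this[of 0 "xy_part \<rho> p' q' - 2 *\<^sub>R v"]
    show "xy_part \<rho> p q = 2 *\<^sub>R u \<and> xy_part \<rho> p' q' = 2 *\<^sub>R v" by simp
  qed (simp add: split_paired_All *)
qed

text \<open>\<open>J\<close> sends \<open>X\<close> to \<open>Y\<close> and moves \<open>u\<close>
  into the second factor. Hence the first component of the Nijenhuis tensor at \<open>X\<close> and
  \<open>u\<close> collects only \<open>[X, u]\<close> and \<open>J [Y, u]\<close>; the possible
  contribution of \<open>J [X, J u]\<close> vanishes because \<open>p' \<times> v\<close> is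
  orthogonal to \<open>v\<close>. Testing on \<open>X\<close> and \<open>v\<close> treats the second
  factor alike.\<close>

lemma cross_eq_zero_of_nijenhuis:
  assumes "norm u = 1" "norm v = 1"
    and N: "\<And>e f. nijenhuis (ext_bracket \<rho> p q p' q') (ext_J u v) e f = 0"
  shows "p \<times> u + (q \<times> u) \<times> u = 0" "p' \<times> v + (q' \<times> v) \<times> v = 0"
  using arg_cong[OF N[of "(0, 0, 1, 0)" "(u, 0, 0, 0)"], of fst]
    arg_cong[OF N[of "(0, 0, 1, 0)" "(0, v, 0, 0)"], of "\<lambda>w. fst (snd w)"] assms(1,2)
  by (simp_all add: nijenhuis_def ext_bracket_def ext_J_def dot_cross_self dot_square_norm cross_mult_right)

lemma parallel_of_integrable_semi_Kaehler:
  fixes u p q :: "real^3"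
  assumes u: "norm u = 1" and N: "p \<times> u + (q \<times> u) \<times> u = 0" and xy: "xy_part \<rho> p q = 2 *\<^sub>R u"
  shows "\<rho> \<noteq> 0 \<and> p = (- 4 / \<rho>) *\<^sub>R u \<and> q = (q \<bullet> u) *\<^sub>R u"
proof -
  have uu: "u \<bullet> u = 1" using u by (simp add: dot_square_norm)
  define n m where "n = p \<times> u" and "m = q \<times> u"
  define p0 q0 where "p0 = p \<bullet> u" and "q0 = q \<bullet> u"
  have n: "n = - (m \<times> u)" using N by (simp add: n_def m_def eq_neg_iff_add_eq_0)
  have "m \<bullet> u = 0" by (simp add: m_def dot_cross_self)
  then have nu: "n \<times> u = m" using uu by (simp add: n cross_cross_left)
  have eq: "p \<times> q - \<rho> *\<^sub>R p = 4 *\<^sub>R u"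
    using arg_cong[OF xy, of "\<lambda>w. 2 *\<^sub>R w"] by (simp add: xy_part_def)
  \<comment> \<open>Crossing with \<open>u\<close> annihilates the right-hand side of
    \<open>eq\<close>.\<close>
  have "(p \<times> q) \<times> u = \<rho> *\<^sub>R n"
    using arg_cong[OF eq, of "\<lambda>w. w \<times> u"] by (simp add: Cross3.left_diff_distrib cross_mult_left n_def)
  then have "\<rho> *\<^sub>R n = p0 *\<^sub>R q - q0 *\<^sub>R p" by (simp add: cross_cross_left p0_def q0_def)
  from arg_cong[OF this, of "\<lambda>w. w \<times> u"]
  have "\<rho> *\<^sub>R m = p0 *\<^sub>R m - q0 *\<^sub>R n"
    by (simp add: cross_mult_left Cross3.left_diff_distrib nu n_def[symmetric] m_def[symmetric])
  \<comment> \<open>Pairing with \<open>m\<close> removes the \<open>q0\<close> term, as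
    \<open>n\<close> is orthogonal to \<open>m\<close>; so \<open>p0\<close> equals
    \<open>\<rho>\<close> as soon as \<open>m\<close> is nonzero.\<close>
  from arg_cong[OF this, of "\<lambda>w. w \<bullet> m"]
  have rho: "\<rho> * (m \<bullet> m) = p0 * (m \<bullet> m)"
    by (simp add: inner_add_left inner_diff_left n dot_cross_self)
  have "(p \<times> q) \<bullet> u = - (m \<bullet> m)"
  proof -
    \<comment> \<open>\<open>(q \<times> u) \<times> u\<close> is minus the part of \<open>q\<close>
      orthogonal to \<open>u\<close>, so the triple product becomes a pairing with
      \<open>p \<times> u\<close>, to which \<open>N\<close> applies.\<close>
    have "(p \<times> q) \<bullet> u = (p \<times> u) \<bullet> ((q \<times> u) \<times> u)"
      using uu by (simp add: cross_cross_left inner_diff_right dot_cross_self) (simp add: cross3_simps)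
    also have "\<dots> = - (n \<bullet> n)" using N by (simp add: n_def m_def add_eq_0_iff)
    also have "n \<bullet> n = m \<bullet> m" using uu \<open>m \<bullet> u = 0\<close> by (simp add: n inner_cross_cross)
    finally show ?thesis .
  qed
  then have *: "- (m \<bullet> m) - \<rho> * p0 = 4"
    using arg_cong[OF eq, of "\<lambda>w. w \<bullet> u"] uu by (simp add: inner_diff_left p0_def)
  have "m = 0"
  proof (rule ccontr)
    assume "m \<noteq> 0"
    then have "- (m \<bullet> m) - \<rho> * \<rho> = 4" using rho * by simp
    then show False using zero_le_square[of \<rho>] inner_ge_zero[of m] by linarith
  qed
  then have "n = 0" by (simp add: n)
  have split: "w = (w \<bullet> u) *\<^sub>R u" if "w \<times> u = 0" for w
    using uu that cross_cross_left[of w u u] by simp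
  have "\<rho> * p0 = - 4" using * \<open>m = 0\<close> by simp
  then have "\<rho> \<noteq> 0" by auto
  moreover from this have "p0 = - 4 / \<rho>" using \<open>\<rho> * p0 = - 4\<close> by (simp add: field_simps)
  ultimately show ?thesis
    using split[of p] split[of q] \<open>n = 0\<close> \<open>m = 0\<close> by (simp add: n_def m_def p0_def)
qed

lemma xy_part_parallel: "\<rho> \<noteq> 0 \<Longrightarrow> xy_part \<rho> ((- 4 / \<rho>) *\<^sub>R u) (r *\<^sub>R u) = 2 *\<^sub>R u"
  by (simp add: xy_part_def cross_mult_left cross_mult_right)

text \<open>Split \<open>a\<close> and \<open>b\<close> along \<open>u\<close>: the quarter turn
  about \<open>u\<close> preserves the cross product of the orthogonal parts, and the mixed terms
  are left.\<close>

lemma unit_cross_identity: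
  fixes u a b :: "real^3"
  assumes "u \<bullet> u = 1"
  shows "a \<times> b - (a \<times> u) \<times> (b \<times> u) = (u \<bullet> b) *\<^sub>R (a \<times> u) - (u \<bullet> a) *\<^sub>R (b \<times> u)"
proof -
  have 1: "u$1 * u$1 + u$2 * u$2 + u$3 * u$3 = 1" using assms by (simp add: inner_vec_def sum_3)
  show ?thesis
    by (simp add: cross3_simps forall_3, intro conjI; use 1 in algebra)
qed

text \<open>\<open>X\<close> and \<open>Y\<close> act on the factors as infinitesimal rotations
  about \<open>u\<close> and \<open>v\<close>. These commute with \<open>J\<close> and annihilate
  \<open>u\<close> and \<open>v\<close>, so the mixed terms cancel; brackets inside the factors are
  governed by \<open>unit_cross_identity\<close>.\<close>

lemma nijenhuis_ext_zero:
  fixes u v :: "real^3"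
  assumes "norm u = 1" "norm v = 1" "xy_part \<rho> (k *\<^sub>R u) (r *\<^sub>R u) = 2 *\<^sub>R u"
    "xy_part \<rho> (k' *\<^sub>R v) (r' *\<^sub>R v) = 2 *\<^sub>R v"
  shows "nijenhuis (ext_bracket \<rho> (k *\<^sub>R u) (r *\<^sub>R u) (k' *\<^sub>R v) (r' *\<^sub>R v)) (ext_J u v) e f = 0"
proof -
  have uv: "u \<bullet> u = 1" "v \<bullet> v = 1" using assms by (simp_all add: dot_square_norm)
  obtain a b x y where e: "e = (a, b, x, y)" by (cases e)
  obtain a' b' x' y' where f: "f = (a', b', x', y')" by (cases f)
  \<comment> \<open>Together with \<open>skew\<close> and \<open>comm\<close>, these rewrites leave
    only cross products with \<open>u\<close> or \<open>v\<close> as right factor, a normal form in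
    which the terms cancel.\<close>
  have aa': "a \<times> a' = (u \<bullet> a') *\<^sub>R (a \<times> u) - (u \<bullet> a) *\<^sub>R (a' \<times> u) - ((a \<times> u) \<bullet> a') *\<^sub>R u"
    using unit_cross_identity[OF uv(1), of a a'] by (simp add: cross_cross_right dot_cross_self algebra_simps)
  have bb': "b \<times> b' = (v \<bullet> b') *\<^sub>R (b \<times> v) - (v \<bullet> b) *\<^sub>R (b' \<times> v) - ((b \<times> v) \<bullet> b') *\<^sub>R v"
    using unit_cross_identity[OF uv(2), of b b'] by (simp add: cross_cross_right dot_cross_self algebra_simps)
  have skew: "u \<times> a = - (a \<times> u)" "u \<times> a' = - (a' \<times> u)" "v \<times> b = - (b \<times> v)" "v \<times> b' = - (b' \<times> v)"
    by (rule cross_skew)+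
  have comm: "a \<bullet> u = u \<bullet> a" "a' \<bullet> u = u \<bullet> a'" "b \<bullet> v = v \<bullet> b" "b' \<bullet> v = v \<bullet> b'"
    by (rule inner_commute)+
  show ?thesis
    unfolding e f
    by (simp add: nijenhuis_def ext_bracket_def ext_J_def assms prod_eq_iff, intro conjI)
      (simp_all add: cross_mult_left cross_mult_right cross_add_left cross_add_right
        Cross3.left_diff_distrib Cross3.right_diff_distrib uv cross_cross_left cross_cross_right
        inner_add_left inner_add_right inner_diff_left inner_diff_right dot_cross_self comm skew
        aa' bb', simp_all add: algebra_simps)
qed

lemma class_W3_ext:
  fixes u v :: "real^3"
  assumes "norm u = 1" "norm v = 1"
  shows "(\<forall>e f. nijenhuis (ext_bracket \<rho> p q p' q') (ext_J u v) e f = 0) \<and>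
      xy_part \<rho> p q = 2 *\<^sub>R u \<and> xy_part \<rho> p' q' = 2 *\<^sub>R v \<longleftrightarrow>
    \<rho> \<noteq> 0 \<and> (\<exists>r r'. p = (- 4 / \<rho>) *\<^sub>R u \<and> q = r *\<^sub>R u \<and> p' = (- 4 / \<rho>) *\<^sub>R v \<and> q' = r' *\<^sub>R v)"
    (is "?L \<longleftrightarrow> ?R")
proof
  assume L: ?L
  then have "p \<times> u + (q \<times> u) \<times> u = 0" "p' \<times> v + (q' \<times> v) \<times> v = 0"
    using cross_eq_zero_of_nijenhuis[OF assms] by blast+
  then have "\<rho> \<noteq> 0 \<and> p = (- 4 / \<rho>) *\<^sub>R u \<and> q = (q \<bullet> u) *\<^sub>R u"
    "\<rho> \<noteq> 0 \<and> p' = (- 4 / \<rho>) *\<^sub>R v \<and> q' = (q' \<bullet> v) *\<^sub>R v"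
    using L parallel_of_integrable_semi_Kaehler assms by blast+
  then show ?R by blast
next
  assume ?R
  then obtain r r' where R: "\<rho> \<noteq> 0" "p = (- 4 / \<rho>) *\<^sub>R u" "q = r *\<^sub>R u"
    "p' = (- 4 / \<rho>) *\<^sub>R v" "q' = r' *\<^sub>R v" by blast
  show ?L
    unfolding R(2-) using nijenhuis_ext_zero[OF assms xy_part_parallel xy_part_parallel] R(1)
    by (simp only: xy_part_parallel simp_thms)
qed

unbundle no cross3_syntax

section \<open>The frame of the Lie group\<close>

lemma comb_eq_sum:
  "length cs = length Es \<Longrightarrow> comb cs Es p = (\<lambda>f. \<Sum>i<length Es. cs ! i * (Es ! i) p f)"
  by (auto simp: comb_def sum_list_sum_nth split_beta atLeast0LessThan)

lemma tangent_sum: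
  assumes "smooth_atlas \<A>" "u \<in> tangent_space \<A> p" "\<And>i. i \<in> I \<Longrightarrow> h i \<in> smooth_functions \<A>"
  shows "u (\<lambda>q. \<Sum>i\<in>I. c i * h i q) = (\<Sum>i\<in>I. c i * u (h i))"
proof -
  \<comment> \<open>Smoothness of the partial sums is carried along because
    \<open>tangent_lincomb\<close> asks for it.\<close>
  have "(\<lambda>q. \<Sum>i\<in>I. c i * h i q) \<in> smooth_functions \<A> \<and>
      u (\<lambda>q. \<Sum>i\<in>I. c i * h i q) = (\<Sum>i\<in>I. c i * u (h i))"
    using assms(3)
  proof (induction I rule: infinite_finite_induct)
    case (insert i I)
    then have s: "h i \<in> smooth_functions \<A>" "(\<lambda>q. \<Sum>i\<in>I. c i * h i q) \<in> smooth_functions \<A>" by auto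
    then have "(\<lambda>q. c i * h i q + (\<Sum>i\<in>I. c i * h i q)) \<in> smooth_functions \<A>"
      by (intro smooth_functions_add smooth_functions_mult smooth_functions_const assms(1))
    moreover have "u (\<lambda>q. c i * h i q + (\<Sum>i\<in>I. c i * h i q)) = c i * u (h i) + u (\<lambda>q. \<Sum>i\<in>I. c i * h i q)"
      using tangent_lincomb[OF assms(1,2) s, of "c i" 1] by simp
    ultimately show ?case using insert by simp
  qed (simp_all add: smooth_functions_const tangent_const[OF assms(1,2)])
  then show ?thesis ..
qed

text \<open>Constant coefficients pass through the derivations, so no derivatives of coefficients
  appear and the bracket is bilinear.\<close>

lemma lie_bracket_comb:
  assumes "smooth_atlas \<A>" "set Es \<subseteq> vector_fields \<A>" "length cs = length Es" "length ds = length Es"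
  shows "lie_bracket (comb cs Es) (comb ds Es) p f =
    (\<Sum>i<length Es. \<Sum>j<length Es. cs ! i * ds ! j * lie_bracket (Es ! i) (Es ! j) p f)"
proof -
  have E: "Es ! i \<in> vector_fields \<A>" if "i < length Es" for i
    using assms(2) that nth_mem by blast
  have c: "comb cs Es q f = (\<Sum>i<length Es. cs ! i * (Es ! i) q f)" if "length cs = length Es" for cs q f
    by (simp add: comb_eq_sum[OF that])
  have "comb cs Es p (\<lambda>q. comb ds Es q f) =
      (\<Sum>i<length Es. \<Sum>j<length Es. cs ! i * ds ! j * (Es ! i) p (\<lambda>q. (Es ! j) q f))"
    if "length cs = length Es" "length ds = length Es" for cs ds
  proof -
    have "(Es ! i) p (\<lambda>q. \<Sum>j<length Es. ds ! j * (Es ! j) q f) =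
        (\<Sum>j<length Es. ds ! j * (Es ! i) p (\<lambda>q. (Es ! j) q f))" if "i < length Es" for i
      using E by (intro tangent_sum[OF assms(1) vector_field_tangent[OF E[OF that]]])
        (simp add: vector_field_smooth)
    then show ?thesis using that by (simp add: c sum_distrib_left mult.assoc)
  qed
  \<comment> \<open>The subtracted half has the roles of the two indices exchanged; swapping its
    double sum aligns it with the other.\<close>
  from this[OF assms(3,4)] this[OF assms(4,3)] show ?thesis
    unfolding lie_bracket_def
    by (simp add: sum_subtractf right_diff_distrib)
      (subst (2) sum.swap, simp add: mult_ac)
qed

definition coords8 :: "algebra8 \<Rightarrow> real list" where
  "coords8 = (\<lambda>(a, b, x, y). [a$1, a$2, a$3, b$1, b$2, b$3, x, y])"

lemma length_coords8 [simp]: "length (coords8 e) = 8"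
  by (simp add: coords8_def split_beta)

lemma sum_lessThan_8: "(\<Sum>i<8. h i) = h 0 + h 1 + h 2 + h 3 + h 4 + h 5 + h 6 + h (7::nat)"
  for h :: "nat \<Rightarrow> 'a::comm_monoid_add"
  by (simp add: eval_nat_numeral add_ac)

lemma inner_coords8: "(\<Sum>i<8. coords8 e ! i * coords8 f ! i) = e \<bullet> f"
  by (simp add: sum_lessThan_8 coords8_def split_beta inner_prod_def inner_vec_def sum_3)

lemma comb_coords8_lincomb:
  assumes "length Es = 8"
  shows "comb (coords8 (a *\<^sub>R v + b *\<^sub>R w)) Es = (\<lambda>p f. a * comb (coords8 v) Es p f + b * comb (coords8 w) Es p f)"
  using assms
  by (intro ext) (simp add: comb_eq_sum sum_lessThan_8 coords8_def split_beta algebra_simps)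

lemma (in riemannian_manifold) comb_metric:
  assumes "set Es \<subseteq> vector_fields \<A>" "orthonormal_at g Es p" "length cs = length Es" "length ds = length Es"
  shows "g p (comb cs Es p) (comb ds Es p) = (\<Sum>i<length Es. cs ! i * ds ! i)"
proof -
  have E: "(Es ! i) p \<in> tangent_space \<A> p" if "i < length Es" for i
    using assms(1) that nth_mem vector_field_tangent by blast
  have t: "comb cs Es p \<in> tangent_space \<A> p" if "length cs = length Es" for cs
    unfolding comb_eq_sum[OF that] using E by (intro tangent_space_sum[OF atlas]) simp
  have "g p (comb cs Es p) (comb ds Es p) = (\<Sum>i<length Es. cs ! i * g p ((Es ! i) p) (comb ds Es p))"
    unfolding comb_eq_sum[OF assms(3)] using E t[OF assms(4)] by (intro metric_sum) auto
  \<comment> \<open>\<open>metric_sum\<close> expands the first argument, so symmetry brings the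
    second combination there.\<close>
  also have "\<dots> = (\<Sum>i<length Es. cs ! i * g p (comb ds Es p) ((Es ! i) p))"
    using E t[OF assms(4)] metric_sym by (intro sum.cong) auto
  also have "\<dots> = (\<Sum>i<length Es. cs ! i * (\<Sum>j<length Es. ds ! j * g p ((Es ! j) p) ((Es ! i) p)))"
    unfolding comb_eq_sum[OF assms(4)] using E by (intro sum.cong refl arg_cong2[of _ _ _ _ times] metric_sum) auto
  also have "\<dots> = (\<Sum>i<length Es. cs ! i * (\<Sum>j<length Es. if j = i then ds ! j else 0))"
    using assms(2) by (intro sum.cong refl arg_cong2[of _ _ _ _ times]) (auto simp: orthonormal_at_def)
  also have "\<dots> = (\<Sum>i<length Es. cs ! i * ds ! i)" by simp
  finally show ?thesis .
qed

lemma almost_hermitian_sum: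
  assumes "smooth_atlas \<A>" "almost_hermitian \<A> g J" "\<And>i. i \<in> I \<Longrightarrow> u i \<in> tangent_space \<A> p"
  shows "J p (\<lambda>f. \<Sum>i\<in>I. c i * u i f) = (\<lambda>f. \<Sum>i\<in>I. c i * J p (u i) f)"
proof -
  have lin: "J p (\<lambda>f. a * u f + b * w f) = (\<lambda>f. a * J p u f + b * J p w f)"
    if "u \<in> tangent_space \<A> p" "w \<in> tangent_space \<A> p" for a b u w
    using assms(2) that by (auto simp: almost_hermitian_def)
  have zero: "J p (\<lambda>f. 0) = (\<lambda>f. 0)"
    using lin[OF tangent_space_zero[OF assms(1)] tangent_space_zero[OF assms(1)], of 0 0] by simp
  show ?thesis
    using assms(3)
  proof (induction I rule: infinite_finite_induct)
    case (insert i I)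
    then show ?case
      using lin[of "u i" "\<lambda>f. \<Sum>i\<in>I. c i * u i f" "c i" 1]
      by (simp add: tangent_space_sum[OF assms(1)])
  qed (simp_all add: zero)
qed

text \<open>The diagonal blocks of the matrix are the cross products with \<open>u\<close> and
  \<open>v\<close>, the off-diagonal ones the rank one maps of \<open>ext_J\<close>.\<close>

lemma J_comb_coords8:
  assumes "smooth_atlas \<A>" "almost_hermitian \<A> g J" "set Es \<subseteq> vector_fields \<A>"
    and Es: "Es = [A, B, C, R, S, T, X, Y]"
    and "has_matrix J Es (J_matrix l1 m1 n1 l2 m2 n2)"
  shows "J p (comb (coords8 e) Es p) = comb (coords8 (ext_J (vector [l1, - m1, n1]) (vector [l2, - m2, n2]) e)) Es p"
proof -
  have len: "length Es = 8" by (simp add: Es)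
  have E: "(Es ! i) p \<in> tangent_space \<A> p" if "i < 8" for i
    using assms(3) that nth_mem[of i Es] len by (intro vector_field_tangent) auto
  have "J p (comb (coords8 e) Es p) = (\<lambda>f. \<Sum>i<8. coords8 e ! i * J p ((Es ! i) p) f)"
    unfolding comb_eq_sum[of "coords8 e" Es, unfolded len, OF length_coords8]
    using E by (intro almost_hermitian_sum[OF assms(1,2)]) simp
  also have "\<dots> = (\<lambda>f. \<Sum>i<8. coords8 e ! i * comb (map (\<lambda>row. row ! i) (J_matrix l1 m1 n1 l2 m2 n2)) Es p f)"
  proof -
    have "J p ((Es ! i) p) = comb (map (\<lambda>row. row ! i) (J_matrix l1 m1 n1 l2 m2 n2)) Es p" if "i < 8" for i
      using assms(5) that unfolding has_matrix_def len by (auto dest: fun_cong[of _ _ p])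
    then show ?thesis by simp
  qed
  also have "\<dots> = comb (coords8 (ext_J (vector [l1, - m1, n1]) (vector [l2, - m2, n2]) e)) Es p"
    by (rule ext, cases e)
      (simp add: sum_lessThan_8 J_matrix_def comb_def Es coords8_def ext_J_def cross3_simps)
  finally show ?thesis .
qed

theorem theorem4p1:
  fixes \<A> :: "('g::{t2_space,second_countable_topology}, real^8) chart set"
    and G :: "'g monoid"
    and g :: "'g metric"
    and nabla :: "'g vfield \<Rightarrow> 'g vfield \<Rightarrow> 'g vfield"
    and J :: "'g endo"
    and A B C R S T X Y :: "'g vfield"
    and \<rho> b11 b21 c11 c12 c21 c22 s14 s24 t14 t15 t24 t25 :: real
    and \<theta>1 \<theta>2 \<theta>3 \<theta>4 \<theta>5 \<theta>6 :: real
    and l1 m1 n1 l2 m2 n2 :: real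
  assumes "lie_group \<A> G"
    and "riemannian_metric \<A> g"
    and "levi_civita \<A> g nabla"
    and "lie_algebra_basis \<A> G [A, B, C, R, S, T, X, Y]"
    and "\<forall>p. orthonormal_at g [A, B, C, R, S, T, X, Y] p"
    and "contains_SU2_SU2 \<A> G [A, B, C, R, S, T]"
    and "killing_metric g [A, B, C, R, S, T]"
    and "lie_bracket A B = comb [2] [C]"
      "lie_bracket B C = comb [2] [A]"
      "lie_bracket C A = comb [2] [B]"
      "lie_bracket R S = comb [2] [T]"
      "lie_bracket S T = comb [2] [R]"
      "lie_bracket T R = comb [2] [S]"
    and "\<forall>E\<in>{A, B, C}. \<forall>F\<in>{R, S, T}. lie_bracket E F = comb [] []"
    and "lie_bracket A X = comb [- b11, - c11] [B, C]"
      "lie_bracket A Y = comb [- b21, - c21] [B, C]"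
      "lie_bracket B X = comb [b11, - c12] [A, C]"
      "lie_bracket B Y = comb [b21, - c22] [A, C]"
      "lie_bracket C X = comb [c11, c12] [A, B]"
      "lie_bracket C Y = comb [c21, c22] [A, B]"
      "lie_bracket R X = comb [- s14, - t14] [S, T]"
      "lie_bracket R Y = comb [- s24, - t24] [S, T]"
      "lie_bracket S X = comb [s14, - t15] [R, T]"
      "lie_bracket S Y = comb [s24, - t25] [R, T]"
      "lie_bracket T X = comb [t14, t15] [R, S]"
      "lie_bracket T Y = comb [t24, t25] [R, S]"
    and "lie_bracket X Y = comb [\<rho>, \<theta>1, \<theta>2, \<theta>3, \<theta>4, \<theta>5, \<theta>6] [X, A, B, C, R, S, T]"
    and "2 * \<theta>1 = - \<rho> * c12 + b11 * c21 - b21 * c11"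
      "2 * \<theta>2 = \<rho> * c11 + b11 * c22 - b21 * c12"
      "2 * \<theta>3 = - \<rho> * b11 + c11 * c22 - c12 * c21"
      "2 * \<theta>4 = - \<rho> * t15 + s14 * t24 - s24 * t14"
      "2 * \<theta>5 = \<rho> * t14 + s14 * t25 - s24 * t15"
      "2 * \<theta>6 = - \<rho> * s14 + t14 * t25 - t15 * t24"
    and "l1\<^sup>2 + m1\<^sup>2 + n1\<^sup>2 = 1" and "l2\<^sup>2 + m2\<^sup>2 + n2\<^sup>2 = 1"
    and "l1 \<noteq> 0" and "l2 \<noteq> 0"
    and "almost_hermitian \<A> g J"
    and "has_matrix J [A, B, C, R, S, T, X, Y] (J_matrix l1 m1 n1 l2 m2 n2)"
  shows "class_W3 \<A> g J nabla \<longleftrightarrow>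
    \<rho> \<noteq> 0 \<and> (\<exists>r1 r2.
      c12 = - (4 * l1) / \<rho> \<and> c11 = - (4 * m1) / \<rho> \<and> b11 = - (4 * n1) / \<rho> \<and>
      c22 = r1 * l1 \<and> c21 = r1 * m1 \<and> b21 = r1 * n1 \<and>
      t15 = - (4 * l2) / \<rho> \<and> t14 = - (4 * m2) / \<rho> \<and> s14 = - (4 * n2) / \<rho> \<and>
      t25 = r2 * l2 \<and> t24 = r2 * m2 \<and> s24 = r2 * n2)"
proof -
  let ?Es = "[A, B, C, R, S, T, X, Y]"
  let ?p = "vector [c12, - c11, b11] :: real^3" and ?q = "vector [c22, - c21, b21] :: real^3"
  let ?p' = "vector [t15, - t14, s14] :: real^3" and ?q' = "vector [t25, - t24, s24] :: real^3"
  let ?u = "vector [l1, - m1, n1] :: real^3" and ?v = "vector [l2, - m2, n2] :: real^3"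
  have len: "length ?Es = 8" by simp
  have atlas: "smooth_atlas \<A>" using assms(1) by (simp add: lie_group_def)
  have la: "set ?Es \<subseteq> lie_algebra \<A> G" "field_span ?Es = lie_algebra \<A> G"
    using assms(4) unfolding lie_algebra_basis_def by blast+
  have vf: "set ?Es \<subseteq> vector_fields \<A>" using la(1) by (auto simp: lie_algebra_def)
  have comb_vf: "comb (coords8 e) ?Es \<in> vector_fields \<A>" for e
  proof -
    have "comb (coords8 e) ?Es \<in> field_span ?Es" by (auto simp: field_span_def)
    then show ?thesis using la(2) by (auto simp: lie_algebra_def)
  qed
  interpret riemannian_manifold \<A> g using atlas assms(2) by unfold_locales
  have norm: "norm ?u = 1" "norm ?v = 1"
    using assms(34,35) by (simp_all add: norm_eq_sqrt_inner inner_vec_def sum_3 power2_eq_square)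
  have theta: "xy_part \<rho> ?p ?q = vector [\<theta>1, \<theta>2, \<theta>3]" "xy_part \<rho> ?p' ?q' = vector [\<theta>4, \<theta>5, \<theta>6]"
    using assms(28-33) by (simp_all add: xy_part_def vec_eq_iff forall_3 cross3_def mult.commute)
  have skew: "lie_bracket E F p f = - lie_bracket F E p f" for E F :: "'g vfield" and p f
    by (simp add: lie_bracket_def)
  have self: "lie_bracket E E p f = 0" for E :: "'g vfield" and p f
    by (simp add: lie_bracket_def)
  note brackets = assms(8-13) assms(15-27)
  have bracket: "lie_bracket (comb (coords8 e) ?Es) (comb (coords8 e') ?Es) =
      comb (coords8 (ext_bracket \<rho> ?p ?q ?p' ?q' e e')) ?Es" for e e'
  proof (intro ext)
    fix p f
    have comm: "lie_bracket E F p f = 0" "lie_bracket F E p f = 0"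
      if "E \<in> {A, B, C}" "F \<in> {R, S, T}" for E F
    proof -
      show "lie_bracket E F p f = 0"
        using bspec[OF bspec[OF assms(14) that(1)] that(2)] by (simp add: comb_def)
      then show "lie_bracket F E p f = 0" using skew[of F E p f] by simp
    qed
    \<comment> \<open>Each bracket is given in one order of its arguments; these instances reduce
      the reversed pairs to it.\<close>
    note rev = skew[of B A] skew[of C B] skew[of A C] skew[of S R] skew[of T S] skew[of R T]
      skew[of X A] skew[of X B] skew[of X C] skew[of X R] skew[of X S] skew[of X T]
      skew[of Y A] skew[of Y B] skew[of Y C] skew[of Y R] skew[of Y S] skew[of Y T] skew[of Y X]
    obtain a b x y where e: "e = (a, b, x, y)" by (cases e)
    obtain a' b' x' y' where e': "e' = (a', b', x', y')" by (cases e')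
    have "lie_bracket (comb (coords8 e) ?Es) (comb (coords8 e') ?Es) p f =
        (\<Sum>i<8. \<Sum>j<8. coords8 e ! i * coords8 e' ! j * lie_bracket (?Es ! i) (?Es ! j) p f)"
      by (rule lie_bracket_comb[OF atlas vf, unfolded len, OF length_coords8 length_coords8])
    also have "\<dots> = comb (coords8 (ext_bracket \<rho> ?p ?q ?p' ?q' e e')) ?Es p f"
      by (simp add: sum_lessThan_8 rev brackets comm self e e' coords8_def ext_bracket_def theta comb_def
          cross3_def algebra_simps)
    finally show "lie_bracket (comb (coords8 e) ?Es) (comb (coords8 e') ?Es) p f =
        comb (coords8 (ext_bracket \<rho> ?p ?q ?p' ?q' e e')) ?Es p f" .
  qed
  \<comment> \<open>This transfers the problem from the manifold to \<open>algebra8\<close>: the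
    conditions become identities for \<open>ext_bracket\<close> and \<open>ext_J\<close>.\<close>
  interpret hermitian_frame \<A> g "\<lambda>e. comb (coords8 e) ?Es" nabla
    "ext_bracket \<rho> ?p ?q ?p' ?q'" J "ext_J ?u ?v"
  proof
    show "DIM(algebra8) = DIM(real^8)" by simp
    show "g p (comb (coords8 e) ?Es p) (comb (coords8 e') ?Es p) = e \<bullet> e'" for p e e'
      using comb_metric[OF vf, unfolded len, OF _ length_coords8 length_coords8] assms(5) inner_coords8
      by simp
    show "J p (comb (coords8 e) ?Es p) = comb (coords8 (ext_J ?u ?v e)) ?Es p" for p e
      by (rule J_comb_coords8[OF atlas assms(38) vf refl assms(39)])
  qed (use comb_vf bracket assms(3,38) bilinear_ext_bracket comb_coords8_lincomb[of ?Es] in simp_all)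
  interpret hermitian_algebra "ext_bracket \<rho> ?p ?q ?p' ?q'" "ext_J ?u ?v"
    by (rule hermitian_algebra_ext[OF norm])
  have "class_W3 \<A> g J nabla \<longleftrightarrow>
    \<rho> \<noteq> 0 \<and> (\<exists>r r'. ?p = (- 4 / \<rho>) *\<^sub>R ?u \<and> ?q = r *\<^sub>R ?u \<and> ?p' = (- 4 / \<rho>) *\<^sub>R ?v \<and> ?q' = r' *\<^sub>R ?v)"
    unfolding class_W3_frame nabla_kaehler_invariant_iff codifferential_ext[OF norm]
    by (rule class_W3_ext[OF norm])
  \<comment> \<open>The second entries of the vectors carry a minus sign, which has to be moved
    across to reach the stated equations.\<close>
  moreover have "- s = t \<longleftrightarrow> s = - t" for s t :: real by auto
  ultimately show ?thesis
    by (simp add: vec_eq_iff forall_3 conj_ac)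
qed

end
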